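(* Let $w$ be an element of the affine Weyl group $W$ of type $\tilde A_2$. The Schubert variety $X_w$ is rationally smooth (at every point) if and only if one of the following holds: (a) $\ell(w)\le3$. (b) $w$ is in an even chamber, the alcove for $w$ shares a vertex with a fundamental root strip, and $\ell(w)=4$. Equivalently, $w=s_is_js_is_k$ for $\{i,j,k\}=\{0,1,2\}$. (c) $w$ is in an odd chamber, the alcove for $w$ shares an edge with a fundamental root strip, and $\ell(w)=4$. Equivalently, $w=s_ks_is_js_i$ for $\{i,j,k\}=\{0,1,2\}$. (d) $w$ is twisted spiral.
   Context: Let $V\cong\mathbb R^2$ be a Euclidean plane with inner product $(\cdot,\cdot)$, containing the root system $\Phi=\{\pm\alpha_1,\pm\alpha_2,\pm\tilde\alpha\}$ of type $A_2$, with simple roots $\alpha_1,\alpha_2$, highest root $\tilde\alpha=\alpha_1+\alpha_2$, and $(\alpha,\alpha)=2$ for all $\alpha\in\Phi$. For $\alpha\in\Phi$, $k\in\mathbb Z$, $s_{\alpha,k}$ is the orthogonal reflection in $H_{\alpha,k}=\{v\mid(\alpha,v)=k\}$. $W$ is the group generated by all $s_{\alpha,k}$, with simple reflections $s_1=s_{\alpha_1,0}$, $s_2=s_{\alpha_2,0}$, $s_0=s_{\tilde\alpha,1}$, length $\ell$ and Bruhat order $\le$. Alcoves are the components of the complement of all $H_{\alpha,k}$; $A_0=\{v\mid (v,\alpha_1)>0,(v,\alpha_2)>0,(v,\tilde\alpha)<1\}$; the alcove for $w\in W$ is $wA_0$. A fundamental root strip is $\{v\mid0\le(\alpha,v)\le1\}$,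 $\alpha\in\{\alpha_1,\alpha_2,\tilde\alpha\}$; $w$ is spiral if $wA_0$ lies in one of them. $w$ is twisted spiral if it is a non-spiral element of the form $w=zs$ with $z$ a spiral element of even length, $s$ a simple reflection, and $\ell(w)=\ell(z)+1$. Chambers are the six components of the complement of the union of the fundamental root strips: I: $(\alpha_1,v)>1,(\alpha_2,v)>1$; II: $(\alpha_1,v)<0,(\tilde\alpha,v)>1$; III: $(\alpha_2,v)>1,(\tilde\alpha,v)<0$; IV: $(\alpha_1,v)<0,(\alpha_2,v)<0$; V: $(\alpha_1,v)>1,(\tilde\alpha,v)<0$; VI: $(\alpha_2,v)<0,(\tilde\alpha,v)>1$. I, III, V are odd; II, IV, VI are even. ("Shares a vertex" means that it meets the strip in a vertex of the alcove and not in an edge.) $\mathcal G$ is the Kac–Moody group over $\mathbb C$ of type $\tilde A_2$ with Weyl group $W$ and standard Borel $\mathcal B$; $X_w=\bigcup_{x\le w}\mathcal Bx\mathcal B/\mathcal B\subset\mathcal G/\mathcal B$ is the Schubert variety, of dimension $\ell(w)$. A point $p$ of an irreducible variety $Y$ of dimension $d$ is rationally smooth if it has a neighborhood $U$ such that for all $y\in U$, $H^i(Y,Y\setminus\{y\};\mathbb Q)$ is $\mathbb Q$ for $i=2d$ and $0$ otherwise; equivalently (Carrell–Peterson), $x\mathcal B$ is rationally smooth in $X_w$ iff for every $y$ with $x\le y\le w$ the number of reflections $r\in W$ with $ry\le w$ equals $\ell(w)$. *)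

theory Defs
  imports "HOL-Analysis.Analysis" "HOL-Homology.Homology"
begin

section \<open>The affine Weyl group and its alcoves\<close>

text \<open>The plane is a two-dimensional Euclidean space with simple roots \<open>a\<close>, \<open>b\<close>
  (\<open>\<alpha>\<^sub>1\<close>, \<open>\<alpha>\<^sub>2\<close> in the usual notation); the highest root is \<open>a + b\<close>.
  The group acts faithfully, so its elements are the affine maps themselves and the
  product is composition.\<close>

definition A2_base :: "'v::euclidean_space \<Rightarrow> 'v \<Rightarrow> bool" where
  "A2_base a b \<longleftrightarrow> DIM('v) = 2 \<and> a \<bullet> a = 2 \<and> b \<bullet> b = 2 \<and> a \<bullet> b = - 1"

definition roots :: "'v::euclidean_space \<Rightarrow> 'v \<Rightarrow> 'v set" where
  "roots a b = {a, - a, b, - b, a + b, - (a + b)}"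

definition affine_refl :: "'v::euclidean_space \<Rightarrow> int \<Rightarrow> 'v \<Rightarrow> 'v" where
  "affine_refl \<gamma> k v = v - (2 * (\<gamma> \<bullet> v - of_int k) / (\<gamma> \<bullet> \<gamma>)) *\<^sub>R \<gamma>"

definition reflections :: "'v::euclidean_space \<Rightarrow> 'v \<Rightarrow> ('v \<Rightarrow> 'v) set" where
  "reflections a b = {affine_refl \<gamma> k | \<gamma> k. \<gamma> \<in> roots a b}"

text \<open>Reflections are involutions, so closing under products suffices.\<close>

inductive_set weyl :: "'v::euclidean_space \<Rightarrow> 'v \<Rightarrow> ('v \<Rightarrow> 'v) set" for a b :: 'v where
  one: "id \<in> weyl a b"
| refl: "r \<in> reflections a b \<Longrightarrow> x \<in> weyl a b \<Longrightarrow> r \<circ> x \<in> weyl a b"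

text \<open>Only the indices \<open>0, 1, 2\<close> are meaningful; every use is restricted to them.\<close>

definition simple_refl :: "'v::euclidean_space \<Rightarrow> 'v \<Rightarrow> nat \<Rightarrow> 'v \<Rightarrow> 'v" where
  "simple_refl a b i =
     (if i = 0 then affine_refl (a + b) 1
      else if i = 1 then affine_refl a 0 else affine_refl b 0)"

definition words :: "nat list set" where
  "words = lists {0, 1, 2}"

definition word_val :: "'v::euclidean_space \<Rightarrow> 'v \<Rightarrow> nat list \<Rightarrow> 'v \<Rightarrow> 'v" where
  "word_val a b is = foldr (\<lambda>i x. simple_refl a b i \<circ> x) is id"

definition weyl_length :: "'v::euclidean_space \<Rightarrow> 'v \<Rightarrow> ('v \<Rightarrow> 'v) \<Rightarrow> nat" where
  "weyl_length a b w = (LEAST n. \<exists>is \<in> words. length is = n \<and> word_val a b is = w)"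

definition bruhat_step :: "'v::euclidean_space \<Rightarrow> 'v \<Rightarrow> ('v \<Rightarrow> 'v) \<Rightarrow> ('v \<Rightarrow> 'v) \<Rightarrow> bool" where
  "bruhat_step a b x y \<longleftrightarrow> x \<in> weyl a b \<and> weyl_length a b x < weyl_length a b y \<and>
     (\<exists>r \<in> reflections a b. y = r \<circ> x)"

definition bruhat_le :: "'v::euclidean_space \<Rightarrow> 'v \<Rightarrow> ('v \<Rightarrow> 'v) \<Rightarrow> ('v \<Rightarrow> 'v) \<Rightarrow> bool" where
  "bruhat_le a b x y \<longleftrightarrow> x \<in> weyl a b \<and> y \<in> weyl a b \<and> (bruhat_step a b)\<^sup>*\<^sup>* x y"

definition fund_alcove :: "'v::euclidean_space \<Rightarrow> 'v \<Rightarrow> 'v set" where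
  "fund_alcove a b = {v. v \<bullet> a > 0 \<and> v \<bullet> b > 0 \<and> v \<bullet> (a + b) < 1}"

definition alcove :: "'v::euclidean_space \<Rightarrow> 'v \<Rightarrow> ('v \<Rightarrow> 'v) \<Rightarrow> 'v set" where
  "alcove a b w = w ` fund_alcove a b"

definition fund_strips :: "'v::euclidean_space \<Rightarrow> 'v \<Rightarrow> 'v set set" where
  "fund_strips a b = (\<lambda>\<gamma>. {v. 0 \<le> \<gamma> \<bullet> v \<and> \<gamma> \<bullet> v \<le> 1}) ` {a, b, a + b}"

definition spiral :: "'v::euclidean_space \<Rightarrow> 'v \<Rightarrow> ('v \<Rightarrow> 'v) \<Rightarrow> bool" where
  "spiral a b w \<longleftrightarrow> w \<in> weyl a b \<and> (\<exists>S \<in> fund_strips a b. alcove a b w \<subseteq> S)"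

definition twisted_spiral :: "'v::euclidean_space \<Rightarrow> 'v \<Rightarrow> ('v \<Rightarrow> 'v) \<Rightarrow> bool" where
  "twisted_spiral a b w \<longleftrightarrow> w \<in> weyl a b \<and> \<not> spiral a b w \<and>
     (\<exists>z. \<exists>i \<in> {0, 1, 2}. spiral a b z \<and> even (weyl_length a b z) \<and>
        w = z \<circ> simple_refl a b i \<and> weyl_length a b w = weyl_length a b z + 1)"

text \<open>In the order I, III, V and II, IV, VI.\<close>

definition odd_chambers :: "'v::euclidean_space \<Rightarrow> 'v \<Rightarrow> 'v set set" where
  "odd_chambers a b =
     {{v. a \<bullet> v > 1 \<and> b \<bullet> v > 1},
      {v. b \<bullet> v > 1 \<and> (a + b) \<bullet> v < 0},
      {v. a \<bullet> v > 1 \<and> (a + b) \<bullet> v < 0}}"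

definition even_chambers :: "'v::euclidean_space \<Rightarrow> 'v \<Rightarrow> 'v set set" where
  "even_chambers a b =
     {{v. a \<bullet> v < 0 \<and> (a + b) \<bullet> v > 1},
      {v. a \<bullet> v < 0 \<and> b \<bullet> v < 0},
      {v. b \<bullet> v < 0 \<and> (a + b) \<bullet> v > 1}}"

definition in_odd_chamber :: "'v::euclidean_space \<Rightarrow> 'v \<Rightarrow> ('v \<Rightarrow> 'v) \<Rightarrow> bool" where
  "in_odd_chamber a b w \<longleftrightarrow> (\<exists>C \<in> odd_chambers a b. alcove a b w \<subseteq> C)"

definition in_even_chamber :: "'v::euclidean_space \<Rightarrow> 'v \<Rightarrow> ('v \<Rightarrow> 'v) \<Rightarrow> bool" where
  "in_even_chamber a b w \<longleftrightarrow> (\<exists>C \<in> even_chambers a b. alcove a b w \<subseteq> C)"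

text \<open>The closed alcove meets the strip in exactly one vertex, respectively in exactly one edge.\<close>

definition shares_vertex :: "'v::euclidean_space \<Rightarrow> 'v \<Rightarrow> ('v \<Rightarrow> 'v) \<Rightarrow> bool" where
  "shares_vertex a b w \<longleftrightarrow> (\<exists>S \<in> fund_strips a b. \<exists>p.
     p extreme_point_of closure (alcove a b w) \<and> closure (alcove a b w) \<inter> S = {p})"

definition shares_edge :: "'v::euclidean_space \<Rightarrow> 'v \<Rightarrow> ('v \<Rightarrow> 'v) \<Rightarrow> bool" where
  "shares_edge a b w \<longleftrightarrow> (\<exists>S \<in> fund_strips a b.
     (closure (alcove a b w) \<inter> S) edge_of closure (alcove a b w))"

section \<open>The flag variety of the Kac--Moody group of affine type\<close>

text \<open>Up to the centre and the one-parameter group of loop rotations, both of which lie in the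
  standard Borel subgroup and do not affect the flag variety, the Kac--Moody group of type
  \<open>A\<^sub>2\<close> affine is the group \<open>SL\<^sub>3\<close> over the Laurent polynomials in \<open>t\<close>, and its
  standard Borel subgroup consists of the matrices over \<open>\<complex>[t]\<close> that are upper
  triangular at \<open>t = 0\<close>.  An element is given by its matrix coefficients:
  \<open>A k\<close> is the coefficient of \<open>t\<close> to the power \<open>k\<close>.\<close>

type_synonym loop = "int \<Rightarrow> complex^3^3"

definition loop_mult :: "loop \<Rightarrow> loop \<Rightarrow> loop" where
  "loop_mult A B = (\<lambda>n. \<Sum>k | A k \<noteq> 0. A k ** B (n - k))"

definition loop_one :: loop where
  "loop_one = (\<lambda>k. if k = 0 then mat 1 else 0)"

definition loop_eval :: "loop \<Rightarrow> complex \<Rightarrow> complex^3^3" where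
  "loop_eval A z = (\<chi> i j. \<Sum>k | A k \<noteq> 0. (A k $ i $ j) * z powi k)"

definition SL3_loops :: "loop set" where
  "SL3_loops = {A. finite {k. A k \<noteq> 0} \<and> (\<forall>z. z \<noteq> 0 \<longrightarrow> det (loop_eval A z) = 1)}"

definition std_borel :: "loop set" where
  "std_borel = {A \<in> SL3_loops. (\<forall>k < 0. A k = 0) \<and>
     A 0 $ 2 $ 1 = 0 \<and> A 0 $ 3 $ 1 = 0 \<and> A 0 $ 3 $ 2 = 0}"

definition flag :: "loop \<Rightarrow> loop set" where
  "flag A = loop_mult A ` std_borel"

text \<open>The analytic topology: the direct limit topology over the finite-dimensional affine
  varieties of matrices with exponents in \<open>[-N, N]\<close>, and its quotient.\<close>

definition SL3_bounded :: "nat \<Rightarrow> loop set" where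
  "SL3_bounded N = {A \<in> SL3_loops. \<forall>k. \<bar>k\<bar> > int N \<longrightarrow> A k = 0}"

definition loop_topology :: "loop topology" where
  "loop_topology = topology (\<lambda>U. U \<subseteq> SL3_loops \<and>
     (\<forall>N. openin (top_of_set (SL3_bounded N)) (U \<inter> SL3_bounded N)))"

definition flag_topology :: "loop set topology" where
  "flag_topology = topology (\<lambda>F. F \<subseteq> flag ` SL3_loops \<and>
     openin loop_topology {A \<in> SL3_loops. flag A \<in> F})"

lemma openin_loop_topology:
  "openin loop_topology U \<longleftrightarrow> U \<subseteq> SL3_loops \<and>
     (\<forall>N. openin (top_of_set (SL3_bounded N)) (U \<inter> SL3_bounded N))"
proof -
  let ?P = "\<lambda>U. U \<subseteq> SL3_loops \<and>
     (\<forall>N. openin (top_of_set (SL3_bounded N)) (U \<inter> SL3_bounded N))"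
  have "?P (S \<inter> T)" if "?P S" "?P T" for S T
  proof (intro conjI allI)
    show "S \<inter> T \<subseteq> SL3_loops" using that by blast
    fix N
    have eq: "S \<inter> T \<inter> SL3_bounded N = (S \<inter> SL3_bounded N) \<inter> (T \<inter> SL3_bounded N)" by blast
    show "openin (top_of_set (SL3_bounded N)) (S \<inter> T \<inter> SL3_bounded N)"
      unfolding eq by (rule openin_Int) (simp_all only: that)
  qed
  moreover have "?P (\<Union>K)" if "\<forall>U\<in>K. ?P U" for K
  proof (intro conjI allI)
    show "\<Union>K \<subseteq> SL3_loops" using that by blast
    fix N
    have eq: "\<Union>K \<inter> SL3_bounded N = (\<Union>U\<in>K. U \<inter> SL3_bounded N)" by blast
    show "openin (top_of_set (SL3_bounded N)) (\<Union>K \<inter> SL3_bounded N)"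
      unfolding eq by (rule openin_Union) (use that in blast)
  qed
  ultimately have "istopology ?P"
    unfolding istopology_def by blast
  then show ?thesis
    unfolding loop_topology_def by (simp only: topology_inverse')
qed

lemma openin_flag_topology:
  "openin flag_topology F \<longleftrightarrow> F \<subseteq> flag ` SL3_loops \<and>
     openin loop_topology {A \<in> SL3_loops. flag A \<in> F}"
proof -
  let ?P = "\<lambda>F. F \<subseteq> flag ` SL3_loops \<and> openin loop_topology {A \<in> SL3_loops. flag A \<in> F}"
  have "?P (S \<inter> T)" if "?P S" "?P T" for S T
  proof
    show "S \<inter> T \<subseteq> flag ` SL3_loops" using that by blast
    have eq: "{A \<in> SL3_loops. flag A \<in> S \<inter> T} =
      {A \<in> SL3_loops. flag A \<in> S} \<inter> {A \<in> SL3_loops. flag A \<in> T}" by blast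
    show "openin loop_topology {A \<in> SL3_loops. flag A \<in> S \<inter> T}"
      unfolding eq by (rule openin_Int) (simp_all only: that)
  qed
  moreover have "?P (\<Union>K)" if "\<forall>F\<in>K. ?P F" for K
  proof
    show "\<Union>K \<subseteq> flag ` SL3_loops" using that by blast
    have eq: "{A \<in> SL3_loops. flag A \<in> \<Union>K} = (\<Union>F\<in>K. {A \<in> SL3_loops. flag A \<in> F})" by blast
    show "openin loop_topology {A \<in> SL3_loops. flag A \<in> \<Union>K}"
      unfolding eq by (rule openin_Union) (use that in blast)
  qed
  ultimately have "istopology ?P"
    unfolding istopology_def by blast
  then show ?thesis
    unfolding flag_topology_def by (simp only: topology_inverse')
qed

text \<open>Representatives of the simple reflections in the normaliser of the diagonal torus \<open>T\<close>;
  the one of index \<open>0\<close> has the entries \<open>1/t\<close>, \<open>1\<close>, \<open>-t\<close> on the antidiagonal.  They induce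
  the identification of the affine Weyl group with \<open>N(T)/T\<close>, so the coset
  \<open>flag (word_lift is)\<close> depends only on the group element \<open>x\<close> spelled by the word \<open>is\<close>;
  it is the point \<open>xB\<close>.\<close>

definition simple_lift :: "nat \<Rightarrow> loop" where
  "simple_lift i =
     (if i = 0 then
        (\<lambda>k. if k = - 1 then vector [vector [0, 0, 1], vector [0, 0, 0], vector [0, 0, 0]]
             else if k = 0 then vector [vector [0, 0, 0], vector [0, 1, 0], vector [0, 0, 0]]
             else if k = 1 then vector [vector [0, 0, 0], vector [0, 0, 0], vector [- 1, 0, 0]]
             else 0)
      else if i = 1 then
        (\<lambda>k. if k = 0 then vector [vector [0, 1, 0], vector [- 1, 0, 0], vector [0, 0, 1]] else 0)
      else
        (\<lambda>k. if k = 0 then vector [vector [1, 0, 0], vector [0, 0, 1], vector [0, - 1, 0]] else 0))"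

definition word_lift :: "nat list \<Rightarrow> loop" where
  "word_lift is = foldr (\<lambda>i A. loop_mult (simple_lift i) A) is loop_one"

definition schubert_points :: "'v::euclidean_space \<Rightarrow> 'v \<Rightarrow> ('v \<Rightarrow> 'v) \<Rightarrow> loop set set" where
  "schubert_points a b w =
     {flag (loop_mult g (word_lift is)) | g is.
        g \<in> std_borel \<and> is \<in> words \<and> bruhat_le a b (word_val a b is) w}"

definition schubert_variety :: "'v::euclidean_space \<Rightarrow> 'v \<Rightarrow> ('v \<Rightarrow> 'v) \<Rightarrow> loop set topology" where
  "schubert_variety a b w = subtopology flag_topology (schubert_points a b w)"

section \<open>Rational smoothness\<close>

text \<open>Relative singular cohomology of \<open>(X, S)\<close> with rational coefficients.  Only the values of a
  cochain on singular chains of \<open>X\<close> matter.  Additivity gives \<open>\<psi> 0 = 0\<close> and the boundary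
  of a \<open>0\<close>-chain is \<open>0\<close>, so a coboundary of degree \<open>0\<close> vanishes.\<close>

definition rel_cochain :: "nat \<Rightarrow> 'a topology \<Rightarrow> 'a set \<Rightarrow> ('a chain \<Rightarrow> rat) \<Rightarrow> bool" where
  "rel_cochain n X S \<phi> \<longleftrightarrow>
     (\<forall>c d. singular_chain n X c \<longrightarrow> singular_chain n X d \<longrightarrow> \<phi> (c + d) = \<phi> c + \<phi> d) \<and>
     (\<forall>c. singular_chain n (subtopology X S) c \<longrightarrow> \<phi> c = 0)"

definition rel_cocycle :: "nat \<Rightarrow> 'a topology \<Rightarrow> 'a set \<Rightarrow> ('a chain \<Rightarrow> rat) \<Rightarrow> bool" where
  "rel_cocycle n X S \<phi> \<longleftrightarrow> rel_cochain n X S \<phi> \<and>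
     (\<forall>c. singular_chain (Suc n) X c \<longrightarrow> \<phi> (chain_boundary (Suc n) c) = 0)"

definition rel_coboundary :: "nat \<Rightarrow> 'a topology \<Rightarrow> 'a set \<Rightarrow> ('a chain \<Rightarrow> rat) \<Rightarrow> bool" where
  "rel_coboundary n X S \<phi> \<longleftrightarrow>
     (\<exists>\<psi>. rel_cochain (n - 1) X S \<psi> \<and>
        (\<forall>c. singular_chain n X c \<longrightarrow> \<phi> c = \<psi> (chain_boundary n c)))"

definition cohomology_zero :: "nat \<Rightarrow> 'a topology \<Rightarrow> 'a set \<Rightarrow> bool" where
  "cohomology_zero n X S \<longleftrightarrow> (\<forall>\<phi>. rel_cocycle n X S \<phi> \<longrightarrow> rel_coboundary n X S \<phi>)"

text \<open>The cohomology space has dimension one over the rationals.\<close>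

definition cohomology_rat :: "nat \<Rightarrow> 'a topology \<Rightarrow> 'a set \<Rightarrow> bool" where
  "cohomology_rat n X S \<longleftrightarrow>
     (\<exists>\<phi>. rel_cocycle n X S \<phi> \<and> \<not> rel_coboundary n X S \<phi> \<and>
        (\<forall>\<psi>. rel_cocycle n X S \<psi> \<longrightarrow>
           (\<exists>q. rel_coboundary n X S (\<lambda>c. \<psi> c - q * \<phi> c))))"

text \<open>Here \<open>d\<close> is the complex dimension of the irreducible variety \<open>Y\<close>.\<close>

definition rationally_smooth_at :: "nat \<Rightarrow> 'a topology \<Rightarrow> 'a \<Rightarrow> bool" where
  "rationally_smooth_at d Y p \<longleftrightarrow>
     (\<exists>U. openin Y U \<and> p \<in> U \<and>
        (\<forall>y \<in> U. \<forall>i. if i = 2 * d then cohomology_rat i Y (topspace Y - {y})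
                      else cohomology_zero i Y (topspace Y - {y})))"

text \<open>The Carrell--Peterson condition at \<open>xB\<close>.\<close>

definition cp_condition :: "'v::euclidean_space \<Rightarrow> 'v \<Rightarrow> ('v \<Rightarrow> 'v) \<Rightarrow> ('v \<Rightarrow> 'v) \<Rightarrow> bool" where
  "cp_condition a b w x \<longleftrightarrow>
     (\<forall>y. bruhat_le a b x y \<and> bruhat_le a b y w \<longrightarrow>
        card {r \<in> reflections a b. bruhat_le a b (r \<circ> y) w} = weyl_length a b w)"

end

theory Submission
  imports Defs
begin

text \<open>On an alcove the three functions \<open>f\<^sub>0 = 1 - (a + b) \<bullet> v\<close>, \<open>f\<^sub>1 = a \<bullet> v\<close>, \<open>f\<^sub>2 = b \<bullet> v\<close>, whose sum is
  \<open>1\<close>, have constant integer parts \<open>(x, y, z)\<close> of sum \<open>0\<close> or \<open>- 1\<close>.  This identifies the Weyl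
  group with such integer triples: the length becomes \<open>\<bar>x\<bar> + \<bar>y\<bar> + \<bar>z\<bar>\<close>, and the diagram automorphisms
  become the permutations of the coordinates.  Up to these permutations the twisted spirals are
  the triples \<open>(- 1, a, - a)\<close>.  The Bruhat interval below such an element consists of the
  alcoves around the points of a triangle in a translate of the root lattice with \<open>a\<close> points on each side.
  For an alcove around a point \<open>p\<close> the reflections that stay in the interval correspond to the pairs of a line
  through \<open>p\<close> parallel to a side and a point of the triangle on it; their number is always
  \<open>2 * a + 1\<close>.  For every unclassified element an explicit element of colength \<open>3\<close> or \<open>4\<close> has
  too many reflections.  Rational smoothness at all points reduces to the torus fixed points, since the
  Borel subgroup acts by homeomorphisms and relative cohomology is a topological invariant.\<close>

section \<open>Integer triples and the Bruhat order\<close>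

text \<open>The count for a twisted spiral does not depend on the alcove, because a reflection
  carries the six alcoves around a vertex to the six around its image: only the image of the vertex
  matters. For the point with parameters \<open>s\<close>, \<open>t\<close> of the triangle the
  three lines carry \<open>s + t + 1\<close>, \<open>a - t\<close> and \<open>a - s\<close> points,
  the point itself included each time. The sum is \<open>2 * a + 1\<close>, the length of
  \<open>(- 1, a, - a)\<close>. Left multiplication by a reflection is affine on triples, and length
  and Bruhat order only involve that side. Twisted spirals, however, are defined by multiplication
  on the right. Which simple reflection crosses a given wall depends on the colours of the vertices;
  the residue of \<open>y - z\<close> recorded by \<open>act\<close> settles this. For a sorted
  triple the sign of the middle coordinate decides between spiral, odd chamber and even chamber, and
  the sum of the coordinates gives the orientation of the alcove. The families of counterexamples
  follow this split.\<close>

datatype family = F0 | F1 | F2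

type_synonym triple = "int \<times> int \<times> int"

fun coord :: "family \<Rightarrow> triple \<Rightarrow> int" where
  "coord F0 (x, y, z) = x"
| "coord F1 (x, y, z) = y"
| "coord F2 (x, y, z) = z"

text \<open>The reflection in the line \<open>f_i = k\<close>, on integer parts. The
  \<open>- 1\<close> arises because the interval from \<open>x\<close> to \<open>x + 1\<close> goes
  to the one from \<open>2 * k - 1 - x\<close> to \<open>2 * k - x\<close>. The other two
  coordinates are exchanged, with a shift dictated by the sum \<open>1\<close> of the three
  functions.\<close>

fun reflect :: "family \<Rightarrow> int \<Rightarrow> triple \<Rightarrow> triple" where
  "reflect F0 k (x, y, z) = (2 * k - 1 - x, - z - k, - y - k)"
| "reflect F1 k (x, y, z) = (- z - k, 2 * k - 1 - y, - x - k)"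
| "reflect F2 k (x, y, z) = (- y - k, - x - k, 2 * k - 1 - z)"

definition triples :: "triple set" where
  "triples = {(x, y, z). x + y + z = 0 \<or> x + y + z = - 1}"

fun len :: "triple \<Rightarrow> nat" where
  "len (x, y, z) = nat (\<bar>x\<bar> + \<bar>y\<bar> + \<bar>z\<bar>)"

text \<open>The line \<open>f_i = k\<close> lies between the alcove and the fundamental alcove,
  where \<open>0 < f_i < 1\<close>; this is why \<open>k = 0\<close> belongs to the negative
  side.\<close>

definition sep :: "family \<Rightarrow> int \<Rightarrow> triple \<Rightarrow> bool" where
  "sep i k n \<longleftrightarrow> 0 < k \<and> k \<le> coord i n \<or> coord i n < k \<and> k \<le> 0"

lemma mem_triples [simp]: "(x, y, z) \<in> triples \<longleftrightarrow> x + y + z = 0 \<or> x + y + z = - 1"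
  by (simp add: triples_def)

lemma reflect_triples [simp]: "reflect i k n \<in> triples \<longleftrightarrow> n \<in> triples"
  by (cases n; cases i; simp; presburger)

lemma reflect_reflect [simp]: "reflect i k (reflect i k n) = n"
  by (cases n; cases i; simp)

lemma abs_sum_reflect:
  fixes x y z k :: int
  assumes "x + y + z = 0 \<or> x + y + z = - 1"
  shows "0 < k \<and> k \<le> x \<or> x < k \<and> k \<le> 0 \<Longrightarrow>
      \<bar>2 * k - 1 - x\<bar> + \<bar>- z - k\<bar> + \<bar>- y - k\<bar> < \<bar>x\<bar> + \<bar>y\<bar> + \<bar>z\<bar>"
    and "\<not> (0 < k \<and> k \<le> x \<or> x < k \<and> k \<le> 0) \<Longrightarrow>
      \<bar>x\<bar> + \<bar>y\<bar> + \<bar>z\<bar> < \<bar>2 * k - 1 - x\<bar> + \<bar>- z - k\<bar> + \<bar>- y - k\<bar>"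
  using assms by (smt (verit))+

lemma len_reflect:
  assumes "n \<in> triples"
  shows "len (reflect i k n) < len n \<longleftrightarrow> sep i k n" "len n < len (reflect i k n) \<longleftrightarrow> \<not> sep i k n"
proof -
  obtain x y z where n: "n = (x, y, z)" by (cases n)
  \<comment> \<open>\<open>abs_sum_reflect\<close> singles out the first coordinate; the rearranged
    sums make it apply to each family.\<close>
  have s: "x + y + z = 0 \<or> x + y + z = - 1" "y + x + z = 0 \<or> y + x + z = - 1"
      "z + x + y = 0 \<or> z + x + y = - 1"
    using assms n by auto
  have nat: "p < q \<Longrightarrow> 0 \<le> p \<Longrightarrow> nat p < nat q" for p q by simp
  have "len (reflect i k n) < len n" if "sep i k n"
    using that s[THEN abs_sum_reflect(1), of k] unfolding n
    by (cases i) (auto simp: sep_def add_ac intro!: nat)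
  moreover have "len n < len (reflect i k n)" if "\<not> sep i k n"
    using that s[THEN abs_sum_reflect(2), of k] unfolding n
    by (cases i) (auto simp: sep_def add_ac intro!: nat)
  ultimately show "len (reflect i k n) < len n \<longleftrightarrow> sep i k n"
      "len n < len (reflect i k n) \<longleftrightarrow> \<not> sep i k n"
    by fastforce+
qed

text \<open>The group acts simply transitively on alcoves, so a reflection is known from the image
  of one alcove. Counting pairs \<open>(i, k)\<close> is therefore the same as counting
  reflections.\<close>

lemma reflect_inject:
  assumes "n \<in> triples" "reflect i k n = reflect j l n"
  shows "i = j \<and> k = l"
proof -
  obtain x y z where n: "n = (x, y, z)" by (cases n)
  show ?thesis
    by (insert assms[unfolded n], cases i; cases j; simp; thin_tac "i = _"; thin_tac "j = _"; presburger)
qed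

definition step :: "triple \<Rightarrow> triple \<Rightarrow> bool" where
  "step m n \<longleftrightarrow> m \<in> triples \<and> len m < len n \<and> (\<exists>i k. n = reflect i k m)"

definition below :: "triple \<Rightarrow> triple \<Rightarrow> bool" where
  "below m n \<longleftrightarrow> m \<in> triples \<and> n \<in> triples \<and> step\<^sup>*\<^sup>* m n"

lemma below_refl [simp]: "n \<in> triples \<Longrightarrow> below n n"
  by (simp add: below_def)

lemma below_trans: "below l m \<Longrightarrow> below m n \<Longrightarrow> below l n"
  unfolding below_def by (meson rtranclp_trans)

lemma below_reflect: "n \<in> triples \<Longrightarrow> \<not> sep i k n \<Longrightarrow> below n (reflect i k n)"
  unfolding below_def using len_reflect(2) reflect_triples
  by (metis (no_types, lifting) r_into_rtranclp step_def)

lemma reflect_below: "n \<in> triples \<Longrightarrow> sep i k n \<Longrightarrow> below (reflect i k n) n"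
  unfolding below_def by (metis (no_types, lifting) len_reflect(1) r_into_rtranclp reflect_reflect reflect_triples step_def)

lemma below_len: "below m n \<Longrightarrow> len m \<le> len n"
proof -
  have "step\<^sup>*\<^sup>* m n \<Longrightarrow> len m \<le> len n"
    by (induction rule: rtranclp_induct) (auto simp: step_def)
  then show "below m n \<Longrightarrow> len m \<le> len n" by (simp add: below_def)
qed

lemma finite_len_le: "finite {n \<in> triples. len n \<le> N}"
proof (rule finite_subset)
  let ?I = "{- int N..int N}"
  show "{n \<in> triples. len n \<le> N} \<subseteq> ?I \<times> ?I \<times> ?I" by auto
qed simp

lemma finite_below: "finite {m. below m n}"
proof (rule finite_subset[OF _ finite_len_le])
  show "{m. below m n} \<subseteq> {m \<in> triples. len m \<le> len n}"
    using below_len unfolding below_def by blast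
qed

text \<open>Closure under lowering reflections confines the lower interval to \<open>S\<close>.
  Conversely, raising inside the finite set \<open>S\<close> must stop, and it can stop only at
  \<open>w\<close>, so all of \<open>S\<close> lies below \<open>w\<close>.\<close>

lemma below_eqI:
  assumes S: "S \<subseteq> triples" "w \<in> S" "finite S"
    and down: "\<And>y i k. y \<in> S \<Longrightarrow> sep i k y \<Longrightarrow> reflect i k y \<in> S"
    and up: "\<And>y. y \<in> S \<Longrightarrow> y \<noteq> w \<Longrightarrow> \<exists>i k. \<not> sep i k y \<and> reflect i k y \<in> S"
  shows "below y w \<longleftrightarrow> y \<in> S"
proof
  assume "below y w"
  then have "step\<^sup>*\<^sup>* y w" by (simp add: below_def)
  then show "y \<in> S"
  proof (induction rule: converse_rtranclp_induct)
    case base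
    show ?case by (rule S)
  next
    case (step x y)
    then obtain i k where y: "y = reflect i k x" and x: "x \<in> triples" "len x < len y"
      unfolding step_def by auto
    have "x = reflect i k y" "sep i k y"
      using x y len_reflect(1)[of y i k] by simp_all
    then show ?case using down step.IH by auto
  qed
next
  assume "y \<in> S"
  define M where "M = Max (len ` S)"
  have M: "len y \<le> M" if "y \<in> S" for y
    using that S by (auto simp: M_def)
  from \<open>y \<in> S\<close> show "below y w"
  proof (induction "M - len y" arbitrary: y rule: less_induct)
    case less
    show ?case
    proof (cases "y = w")
      case True
      then show ?thesis using S by auto
    next
      case False
      then obtain i k where ik: "\<not> sep i k y" "reflect i k y \<in> S"
        using up less.prems by blast
      have "y \<in> triples" using less.prems S by auto
      then have "len y < len (reflect i k y)" using ik by (simp add: len_reflect)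
      then have "M - len (reflect i k y) < M - len y"
        using M[OF ik(2)] by linarith
      then have "below (reflect i k y) w" using less.hyps ik by blast
      then show ?thesis using below_reflect[OF \<open>y \<in> triples\<close> ik(1)] below_trans by blast
    qed
  qed
qed

text \<open>The Carrell--Peterson condition at the identity, which includes it at every \<open>y \<le> w\<close>.\<close>

definition smooth :: "triple \<Rightarrow> bool" where
  "smooth w \<longleftrightarrow> (\<forall>y. below y w \<longrightarrow> card {(i, k). below (reflect i k y) w} = len w)"

lemma finite_reflect_below:
  assumes "y \<in> triples" shows "finite {(i, k). below (reflect i k y) w}"
proof -
  let ?f = "\<lambda>(i, k). reflect i k y"
  have "inj_on ?f {(i, k). below (reflect i k y) w}"
    using reflect_inject[OF assms] by (auto simp: inj_on_def)
  moreover have "?f ` {(i, k). below (reflect i k y) w} \<subseteq> {m. below m w}" by auto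
  ultimately show ?thesis using finite_below by (rule inj_on_finite)
qed

section \<open>Counting reflections family by family\<close>

lemma family_split: "{(i, k). P i k} = Pair F0 ` {k. P F0 k} \<union> Pair F1 ` {k. P F1 k} \<union> Pair F2 ` {k. P F2 k}"
proof -
  have "(i, k) \<in> Pair F0 ` {k. P F0 k} \<union> Pair F1 ` {k. P F1 k} \<union> Pair F2 ` {k. P F2 k} \<longleftrightarrow> P i k" for i k
    by (cases i) auto
  then show ?thesis by auto
qed

lemma card_family:
  assumes "\<And>i. finite {k. P i k}"
  shows "card {(i, k). P i k} = card {k. P F0 k} + card {k. P F1 k} + card {k. P F2 k}"
proof -
  have "card (Pair F0 ` {k. P F0 k} \<union> Pair F1 ` {k. P F1 k} \<union> Pair F2 ` {k. P F2 k}) =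
     card (Pair F0 ` {k. P F0 k}) + card (Pair F1 ` {k. P F1 k}) + card (Pair F2 ` {k. P F2 k})"
  proof (subst card_Un_disjoint)
    show "card (Pair F0 ` {k. P F0 k} \<union> Pair F1 ` {k. P F1 k}) + card (Pair F2 ` {k. P F2 k}) =
      card (Pair F0 ` {k. P F0 k}) + card (Pair F1 ` {k. P F1 k}) + card (Pair F2 ` {k. P F2 k})"
      by (subst card_Un_disjoint) (use assms in auto)
  qed (use assms in auto)
  then show ?thesis unfolding family_split by (simp add: card_image inj_on_def)
qed

lemma card_sep_coord: "finite {k. sep i k y}" "card {k. sep i k y} = nat \<bar>coord i y\<bar>"
proof -
  have "{k. sep i k y} = (if 0 \<le> coord i y then {1..coord i y} else {coord i y + 1..0})"
    by (auto simp: sep_def)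
  then show "finite {k. sep i k y}" "card {k. sep i k y} = nat \<bar>coord i y\<bar>" by auto
qed

lemma card_sep: "card {(i, k). sep i k y} = len y" "finite {(i, k). sep i k y}"
proof -
  obtain x1 x2 x3 where y: "y = (x1, x2, x3)" by (cases y)
  show "card {(i, k). sep i k y} = len y"
    using card_family[of "\<lambda>i k. sep i k y", OF card_sep_coord(1)]
    unfolding card_sep_coord y by (simp add: nat_add_distrib)
  show "finite {(i, k). sep i k y}"
    unfolding family_split using card_sep_coord(1) by simp
qed

text \<open>A path of raising reflections given as explicit data, so that \<open>simp\<close> can
  verify a Bruhat relation between triples with symbolic entries without searching for the
  path.\<close>

fun climbs :: "(family \<times> int) list \<Rightarrow> triple \<Rightarrow> triple \<Rightarrow> bool" where
  "climbs [] m n \<longleftrightarrow> m = n"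
| "climbs ((i, k) # ps) m n \<longleftrightarrow> \<not> sep i k m \<and> climbs ps (reflect i k m) n"

lemma climbs_below: "n \<in> triples \<Longrightarrow> climbs ps m n \<Longrightarrow> below m n \<and> m \<in> triples"
proof (induction ps m n rule: climbs.induct)
  case (2 i k ps m n)
  then have "below (reflect i k m) n \<and> reflect i k m \<in> triples" by simp
  moreover have "\<not> sep i k m" using 2 by simp
  ultimately show ?case using below_reflect below_trans reflect_triples by blast
qed simp

text \<open>The first entries of the chains in \<open>Q\<close> are reflections that raise \<open>y\<close> and stay below \<open>w\<close>; the
  \<open>len y\<close> reflections that lower \<open>y\<close> always stay below \<open>w\<close>.\<close>

lemma not_smoothI:
  assumes "w \<in> triples" "Q \<noteq> []" "\<forall>ps \<in> set Q. ps \<noteq> [] \<and> climbs ps y w"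
    and "distinct (map hd Q)" "len w < len y + length Q"
  shows "\<not> smooth w"
proof
  assume "smooth w"
  let ?C = "{(i, k). below (reflect i k y) w}" and ?D = "{(i, k). sep i k y}"
  have y: "below y w" "y \<in> triples"
    using assms(1-3) climbs_below by (metis hd_in_set)+
  have U: "p \<notin> ?D" "p \<in> ?C" if p: "p \<in> hd ` set Q" for p
  proof -
    obtain ps where ps: "ps \<in> set Q" "p = hd ps" using p by auto
    then obtain i k qs where "ps = (i, k) # qs" using assms(3) by (metis list.collapse surj_pair)
    then show "p \<notin> ?D" "p \<in> ?C" using assms(1,3) ps climbs_below by fastforce+
  qed
  have "?D \<subseteq> ?C" using reflect_below y below_trans by blast
  then have "?D \<union> hd ` set Q \<subseteq> ?C" using U by blast
  then have "card (?D \<union> hd ` set Q) \<le> card ?C"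
    by (rule card_mono[OF finite_reflect_below[OF y(2)]])
  moreover have "card (?D \<union> hd ` set Q) = len y + length Q"
    using card_sep[of y] U(1) assms(4)
    by (subst card_Un_disjoint) (auto simp: distinct_card simp flip: set_map)
  ultimately show False using \<open>smooth w\<close> y(1) assms(5) unfolding smooth_def by auto
qed

section \<open>Elements that are not rationally smooth\<close>

text \<open>Four raising reflections at colength 3 are one too many. The bound on \<open>m\<close>
  keeps \<open>m - 2\<close> non-negative, so that \<open>y\<close> has length
  \<open>2 * m - 3\<close>.\<close>

lemma not_smooth_spiral_even:
  assumes "m \<ge> 2" shows "\<not> smooth (- m, 0, m)"
  by (rule not_smoothI[where y = "(1 - m, 0, m - 2)" and Q =
    "[[(F1, 0), (F0, 2 - m), (F0, 1 - m)], [(F1, 1), (F2, 0), (F2, 1)],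
      [(F2, 0), (F0, 0), (F2, 1)], [(F2, m - 1), (F0, 1 - m), (F2, m)]]"])
    (use assms in \<open>simp_all add: sep_def\<close>)

lemma not_smooth_spiral_odd:
  assumes "m \<ge> 2" shows "\<not> smooth (- m - 1, 0, m)"
  by (rule not_smoothI[where y = "(1 - m, 0, m - 1)" and Q =
    "[[(F0, 1 - m), (F1, 1), (F2, m)], [(F1, 0), (F0, 1 - m), (F0, - m)],
      [(F1, 1), (F2, 0), (F2, 1)], [(F2, 0), (F0, 0), (F2, 1)]]"])
    (use assms in \<open>simp_all add: sep_def\<close>)

lemma not_smooth_odd_down:
  assumes "a \<ge> 1" "b \<ge> 2" shows "\<not> smooth (- a - b - 1, a, b)"
  by (rule not_smoothI[where y = "(1 - a - b, a, b - 1)" and Q =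
    "[[(F0, 1 - a - b), (F1, 1 + a), (F2, b)], [(F1, 1 + a), (F2, 0), (F2, 1)],
      [(F2, 0), (F0, - a), (F2, 1)], [(F2, b), (F1, a), (F0, - a - b)]]"])
    (use assms in \<open>simp_all add: sep_def\<close>)

text \<open>The case \<open>a = b = 1\<close> of the previous shape. There the second chain of
  \<open>not_smooth_odd_down\<close> would cross a line that already separates, so the defect is
  exhibited lower down: six raising reflections at an element of length 1 and colength 4.\<close>

lemma not_smooth_odd_down_corner: "\<not> smooth (- 3, 1, 1)"
  by (rule not_smoothI[where y = "(- 1, 0, 0)" and Q =
    "[[(F0, - 1), (F0, - 2)], [(F0, 1), (F0, 0)], [(F1, 0), (F0, 0), (F0, - 1), (F1, 1)],
      [(F1, 1), (F0, - 1), (F1, 2), (F2, 1)], [(F2, 0), (F0, 0), (F0, - 1), (F2, 1)],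
      [(F2, 1), (F0, - 1), (F1, 1), (F0, - 2)]]"])
    (simp_all add: sep_def)

text \<open>Unlike in the other families with parameters \<open>a\<close> and \<open>b\<close>, the
  witness \<open>y\<close> leaves the chamber of \<open>w\<close>: it lies in an even chamber, while
  \<open>w\<close> lies in an odd one.\<close>

lemma not_smooth_odd_up:
  assumes "a \<ge> 1" "b \<ge> 2" shows "\<not> smooth (- a - b, a, b)"
  by (rule not_smoothI[where y = "(1 - b, - a, a + b - 2)" and Q =
    "[[(F0, 1 - b), (F0, - b), (F1, 1)], [(F0, 1), (F0, 0), (F1, 1)],
      [(F1, 1), (F2, 0), (F2, 1)], [(F2, 0), (F0, 0), (F2, 1)]]"])
    (use assms in \<open>simp_all add: sep_def\<close>)

lemma not_smooth_even_up:
  assumes "a \<ge> 2" "b \<ge> 1" shows "\<not> smooth (- a, - b, a + b)"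
  by (rule not_smoothI[where y = "(1 - a, - b, a + b - 2)" and Q =
    "[[(F0, 1 - a), (F0, - a), (F1, 1 - b)], [(F0, 1), (F0, 0), (F1, 1 - b)],
      [(F1, - b), (F0, 2 - a), (F0, 1 - a)], [(F2, a + b - 1), (F0, 1 - a), (F2, a + b)]]"])
    (use assms in \<open>simp_all add: sep_def\<close>)

text \<open>For \<open>a = 1\<close> or \<open>b = 1\<close> the triple would be a twisted spiral.
  The excess shows at colength 4, with six raising reflections.\<close>

lemma not_smooth_even_down:
  assumes "a \<ge> 2" "b \<ge> 2" shows "\<not> smooth (- a, - b, a + b - 1)"
  by (rule not_smoothI[where y = "(1 - a, 1 - b, a + b - 3)" and Q =
    "[[(F0, 1 - a), (F0, - a), (F1, 2 - b), (F1, 1 - b)],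
      [(F0, 1), (F0, 0), (F1, 2 - b), (F1, 1 - b)],
      [(F1, 1 - b), (F0, 2 - a), (F0, 1 - a), (F1, 1 - b)],
      [(F1, 1), (F1, 0), (F0, 2 - a), (F0, 1 - a)],
      [(F2, 0), (F2, 1)], [(F2, a + b - 2), (F2, a + b - 1)]]"])
    (use assms in \<open>simp_all add: sep_def\<close>)

section \<open>Twisted spirals and elements of small length\<close>

text \<open>An alcove surrounds each of its three vertices.  The vertices \<open>corner a s t\<close> have one colour, so
  an alcove surrounds at most one of them; \<open>corner a 0 0\<close> is the vertex of \<open>(- 1, a, - a)\<close> at which its
  two walls facing the fundamental alcove meet.\<close>

fun surrounds :: "triple \<Rightarrow> triple \<Rightarrow> bool" where
  "surrounds (x, y, z) (p, q, r) \<longleftrightarrow>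
     p - 1 \<le> x \<and> x \<le> p \<and> q - 1 \<le> y \<and> y \<le> q \<and> r - 1 \<le> z \<and> z \<le> r \<and>
     p + q + r - 2 \<le> x + y + z \<and> x + y + z \<le> p + q + r - 1"

definition corner :: "int \<Rightarrow> int \<Rightarrow> int \<Rightarrow> triple" where
  "corner a s t = (s - t, a - 2 * s - t, 1 - a + s + 2 * t)"

definition star :: "int \<Rightarrow> triple set" where
  "star a = {n. \<exists>s t. 0 \<le> s \<and> 0 \<le> t \<and> s + t < a \<and> surrounds n (corner a s t)}"

lemma surrounds_unique:
  assumes "surrounds n (corner a s t)" "surrounds n (corner a s' t')"
  shows "s = s' \<and> t = t'"
  using assms by (cases n) (auto simp: corner_def)

lemma mem_star_iff:
  assumes "surrounds n (corner a s t)"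
  shows "n \<in> star a \<longleftrightarrow> 0 \<le> s \<and> 0 \<le> t \<and> s + t < a"
  using assms surrounds_unique unfolding star_def by blast

text \<open>The parameters \<open>s\<close> and \<open>t\<close> count translations of
  \<open>corner a 0 0\<close> by minus the first and by plus the second simple root, so reflections
  permute the corners and the alcoves around them follow. The families \<open>F0\<close>,
  \<open>F1\<close>, \<open>F2\<close> preserve \<open>s + t\<close>, \<open>t\<close> and
  \<open>s\<close> respectively, which names the line along which the corner moves.\<close>

lemma surrounds_reflect:
  assumes "surrounds n (corner a s t)"
  shows "surrounds (reflect F0 k n) (corner a (t + k) (s - k))"
    and "surrounds (reflect F1 k n) (corner a (a - s - t - k) t)"
    and "surrounds (reflect F2 k n) (corner a s (a - 1 - s - t + k))"
  using assms by (cases n; auto simp: corner_def)+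

lemma reflect_star_iff:
  assumes "surrounds n (corner a s t)" "0 \<le> s" "0 \<le> t" "s + t < a"
  shows "reflect F0 k n \<in> star a \<longleftrightarrow> k \<in> {- t..s}"
    and "reflect F1 k n \<in> star a \<longleftrightarrow> k \<in> {1 - s..a - s - t}"
    and "reflect F2 k n \<in> star a \<longleftrightarrow> k \<in> {1 - a + s + t..t}"
  using assms(2-) unfolding mem_star_iff[OF surrounds_reflect(1)[OF assms(1)]]
    mem_star_iff[OF surrounds_reflect(2)[OF assms(1)]]
    mem_star_iff[OF surrounds_reflect(3)[OF assms(1)]]
  by auto

lemma star_subset_triples: "star a \<subseteq> triples"
  unfolding star_def by (auto simp: corner_def)

lemma finite_star: "finite (star a)"
proof (rule finite_subset)
  let ?I = "{- 3 * \<bar>a\<bar> - 3..3 * \<bar>a\<bar> + 3}"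
  show "star a \<subseteq> ?I \<times> ?I \<times> ?I"
    unfolding star_def by (auto simp: corner_def)
qed simp

lemma coord_surrounds:
  assumes "surrounds n (corner a s t)"
  shows "s - t - 1 \<le> coord F0 n" "coord F0 n \<le> s - t"
    "a - 2 * s - t - 1 \<le> coord F1 n" "coord F1 n \<le> a - 2 * s - t"
    "s + 2 * t - a \<le> coord F2 n" "coord F2 n \<le> 1 - a + s + 2 * t"
    "- 1 \<le> coord F0 n + coord F1 n + coord F2 n"
    "coord F0 n + coord F1 n + coord F2 n \<le> 0"
  using assms by (cases n; simp add: corner_def)+

text \<open>Raising is a walk to the vertex \<open>corner a 0 0\<close>: the corner is moved to the
  side \<open>s = 0\<close> or \<open>t = 0\<close> of the triangle until both vanish, and then the
  alcove is turned around the vertex until it is \<open>(- 1, a, - a)\<close>.\<close>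

lemma below_twisted_iff:
  assumes "a \<ge> 1"
  shows "below y (- 1, a, - a) \<longleftrightarrow> y \<in> star a"
proof (rule below_eqI)
  show "star a \<subseteq> triples" by (rule star_subset_triples)
  show "finite (star a)" by (rule finite_star)
  have "surrounds (- 1, a, - a) (corner a 0 0)" by (simp add: corner_def)
  then show "(- 1, a, - a) \<in> star a" using assms mem_star_iff by fastforce
next
  fix y i k
  assume "y \<in> star a" "sep i k y"
  then obtain s t where st: "0 \<le> s" "0 \<le> t" "s + t < a" "surrounds y (corner a s t)"
    unfolding star_def by blast
  note iff = reflect_star_iff[OF st(4,1-3)]
  show "reflect i k y \<in> star a"
    using \<open>sep i k y\<close> st(1-3) coord_surrounds[OF st(4)] by (cases i) (auto simp: iff sep_def)
next
  fix y
  assume "y \<in> star a" and neq: "y \<noteq> (- 1, a, - a)"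
  then obtain s t where st: "0 \<le> s" "0 \<le> t" "s + t < a" "surrounds y (corner a s t)"
    unfolding star_def by blast
  note iff = reflect_star_iff[OF st(4,1-3)]
  note y = coord_surrounds[OF st(4)]
  consider "s > 0" | "t > 0" | "s = 0" "t = 0" "coord F1 y < a" | "s = 0" "t = 0" "coord F1 y \<ge> a"
    using st by linarith
  then show "\<exists>i k. \<not> sep i k y \<and> reflect i k y \<in> star a"
  proof cases
    case 1
    \<comment> \<open>This \<open>k\<close> makes the new corner \<open>corner a 0 t\<close>; in the
      next case the corresponding choice gives \<open>corner a s 0\<close>.\<close>
    then have "\<not> sep F1 (a - s - t) y \<and> reflect F1 (a - s - t) y \<in> star a"
      unfolding iff using st(1-3) y by (auto simp: sep_def)
    then show ?thesis by blast
  next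
    case 2
    then have "\<not> sep F2 (1 - a + s + t) y \<and> reflect F2 (1 - a + s + t) y \<in> star a"
      unfolding iff using st(1-3) y by (auto simp: sep_def)
    then show ?thesis by blast
  next
    case 3
    \<comment> \<open>The line \<open>f_1 = a\<close> passes through \<open>corner a 0 0\<close>, so
      the corner stays and the alcove crosses the line.\<close>
    then have "\<not> sep F1 a y \<and> reflect F1 a y \<in> star a"
      unfolding iff using st(1-3) y by (auto simp: sep_def)
    then show ?thesis by blast
  next
    case 4
    \<comment> \<open>Of the six alcoves around the vertex three lie beyond \<open>f_1 = a\<close>:
      the target and its neighbours across the walls \<open>f_0 = 0\<close> and
      \<open>f_2 = 1 - a\<close>.\<close>
    have "\<not> (coord F0 y = - 1 \<and> coord F1 y = a \<and> coord F2 y = - a)"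
      using neq by (cases y) auto
    with 4 have "\<not> sep F0 0 y \<and> reflect F0 0 y \<in> star a \<or>
      \<not> sep F2 (1 - a) y \<and> reflect F2 (1 - a) y \<in> star a"
      unfolding iff using st(1-3) y assms by (auto simp: sep_def)
    then show ?thesis by blast
  qed
qed

lemma smooth_twisted:
  assumes "a \<ge> 1"
  shows "smooth (- 1, a, - a)"
  unfolding smooth_def below_twisted_iff[OF assms]
proof (intro allI impI)
  fix y assume "y \<in> star a"
  then obtain s t where st: "0 \<le> s" "0 \<le> t" "s + t < a" "surrounds y (corner a s t)"
    unfolding star_def by blast
  note iff = reflect_star_iff[OF st(4,1-3)]
  have eq: "{k. reflect F0 k y \<in> star a} = {- t..s}"
      "{k. reflect F1 k y \<in> star a} = {1 - s..a - s - t}"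
      "{k. reflect F2 k y \<in> star a} = {1 - a + s + t..t}"
    using iff by auto
  have fin: "finite {k. reflect i k y \<in> star a}" for i
    by (cases i) (simp_all add: eq)
  have "card {(i, k). reflect i k y \<in> star a} = nat (s + t + 1) + nat (a - t) + nat (a - s)"
    unfolding card_family[of "\<lambda>i k. reflect i k y \<in> star a", OF fin] eq by simp
  then show "card {(i, k). reflect i k y \<in> star a} = len (- 1, a, - a)"
    using st by simp
qed

text \<open>An executable membership test, which lets \<open>code_simp\<close> evaluate
  \<open>closed_list\<close>.\<close>

lemma triples_code [code_unfold]:
  "n \<in> triples \<longleftrightarrow> coord F0 n + coord F1 n + coord F2 n \<in> {0, - 1}"
  by (cases n) simp

text \<open>The bound \<open>3\<close> on the coordinates makes it sufficient to search \<open>k\<close> in \<open>[-3..3]\<close>.\<close>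

definition closed_list :: "triple \<Rightarrow> triple list \<Rightarrow> bool" where
  "closed_list w S \<longleftrightarrow> w \<in> set S \<and>
     (\<forall>y \<in> set S. y \<in> triples \<and> (\<forall>i \<in> set [F0, F1, F2]. \<bar>coord i y\<bar> \<le> 3) \<and>
       (\<forall>i \<in> set [F0, F1, F2]. \<forall>k \<in> set [-3..3]. sep i k y \<longrightarrow> reflect i k y \<in> set S) \<and>
       (y = w \<or> (\<exists>i \<in> set [F0, F1, F2]. \<exists>k \<in> set [-3..3]. \<not> sep i k y \<and> reflect i k y \<in> set S)) \<and>
       length (filter (\<lambda>(i, k). reflect i k y \<in> set S) (List.product [F0, F1, F2] [-3..3])) = len w)"

lemma smooth_closed_list:
  assumes "closed_list w S"
  shows "smooth w"
proof -
  have fam: "i \<in> set [F0, F1, F2]" for i by (cases i) auto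
  have b: "\<bar>coord i y\<bar> \<le> 3" if "y \<in> set S" for i y
    using that assms fam[of i] unfolding closed_list_def by blast
  have k: "k \<in> set [-3..3]" if "y \<in> set S" "sep i k y \<or> reflect i k y \<in> set S" for i k y
  proof -
    \<comment> \<open>Two coordinates of absolute value at most 3 add up to
      \<open>2 * k - 1\<close>, which confines \<open>k\<close> to \<open>-2..3\<close>.\<close>
    have "coord i (reflect i k y) = 2 * k - 1 - coord i y"
      by (cases y; cases i) simp_all
    then show ?thesis
      using that(2) b[OF that(1), of i] b[of "reflect i k y" i] by (auto simp: sep_def)
  qed
  have iff: "below y w \<longleftrightarrow> y \<in> set S" for y
  proof (rule below_eqI)
    show "set S \<subseteq> triples" "w \<in> set S" using assms unfolding closed_list_def by auto
    show "reflect i k y \<in> set S" if "y \<in> set S" "sep i k y" for y i k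
      using assms that k[OF that(1)] fam unfolding closed_list_def by blast
    show "\<exists>i k. \<not> sep i k y \<and> reflect i k y \<in> set S" if "y \<in> set S" "y \<noteq> w" for y
      using assms that unfolding closed_list_def by blast
  qed simp
  show ?thesis
    unfolding smooth_def iff
  proof (intro allI impI)
    fix y assume y: "y \<in> set S"
    let ?F = "filter (\<lambda>(i, k). reflect i k y \<in> set S) (List.product [F0, F1, F2] [-3..3])"
    have "(i, k) \<in> {(i, k). reflect i k y \<in> set S} \<longleftrightarrow> (i, k) \<in> set ?F" for i k
      using k[OF y, of i k] fam[of i]
      unfolding set_filter set_product mem_Collect_eq mem_Times_iff case_prod_conv fst_conv snd_conv
      by blast
    then have "{(i, k). reflect i k y \<in> set S} = set ?F" unfolding set_eq_iff split_paired_All by blast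
    moreover have "distinct (List.product [F0, F1, F2] [-3..3::int])"
      by (intro distinct_product) auto
    then have "card (set ?F) = length ?F" by (intro distinct_card distinct_filter)
    moreover have "length ?F = len w"
      using assms y unfolding closed_list_def by blast
    ultimately show "card {(i, k). reflect i k y \<in> set S} = len w" by (simp only:)
  qed
qed

text \<open>Up to permutation of the coordinates these are the smooth triples that are not twisted
  spirals. Each list is the whole lower interval.\<close>

lemma smooth_small:
  "smooth (0, 0, 0)"
  "smooth (- 1, 0, 0)"
  "smooth (- 1, 0, 1)"
  "smooth (- 2, 0, 1)"
  "smooth (- 2, 1, 1)"
  "smooth (- 1, - 1, 2)"
proof -
  show "smooth (0, 0, 0)"
    by (rule smooth_closed_list[of _ "[(0, 0, 0)]"]) code_simp
  show "smooth (- 1, 0, 0)"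
    by (rule smooth_closed_list[of _ "[(0, 0, 0), (-1, 0, 0)]"]) code_simp
  show "smooth (- 1, 0, 1)"
    by (rule smooth_closed_list[of _ "[(0, 0, 0), (-1, 0, 0), (0, -1, 0), (-1, 0, 1)]"]) code_simp
  show "smooth (- 2, 0, 1)"
    by (rule smooth_closed_list[of _ "[(0, 0, 0), (-1, 0, 0), (0, -1, 0), (0, 0, -1), (-1, 0, 1),
      (-1, 1, 0), (1, -1, 0), (-2, 0, 1)]"]) code_simp
  show "smooth (- 2, 1, 1)"
    by (rule smooth_closed_list[of _ "[(0, 0, 0), (-1, 0, 0), (0, -1, 0), (0, 0, -1), (-1, 0, 1),
      (-1, 1, 0), (1, -1, 0), (1, 0, -1), (-2, 0, 1), (-2, 1, 0), (1, -1, -1), (-2, 1, 1)]"]) code_simp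
  show "smooth (- 1, - 1, 2)"
    by (rule smooth_closed_list[of _ "[(0, 0, 0), (-1, 0, 0), (0, -1, 0), (0, 0, -1), (-1, 0, 1),
      (-1, 1, 0), (0, -1, 1), (1, -1, 0), (-2, 0, 1), (-1, -1, 1), (0, -2, 1), (-1, -1, 2)]"]) code_simp
qed

section \<open>The classification for triples\<close>

fun rot :: "triple \<Rightarrow> triple" where
  "rot (x, y, z) = (y, z, x)"

fun flip :: "triple \<Rightarrow> triple" where
  "flip (x, y, z) = (y, x, z)"

text \<open>This collects what \<open>below\<close> and \<open>smooth\<close> refer to. The same
  \<open>k\<close> stands on both sides because a diagram automorphism permutes the three functions
  \<open>f_i\<close> and keeps their values.\<close>

definition symmetry :: "(triple \<Rightarrow> triple) \<Rightarrow> bool" where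
  "symmetry f \<longleftrightarrow> bij f \<and> (\<forall>n. (f n \<in> triples \<longleftrightarrow> n \<in> triples) \<and> len (f n) = len n) \<and>
     (\<exists>g. bij g \<and> (\<forall>i k n. f (reflect i k n) = reflect (g i) k (f n)))"

lemma symmetry_rot: "symmetry rot"
  unfolding symmetry_def
proof (intro conjI exI allI)
  show "bij rot"
    by (rule o_bij[of "rot \<circ> rot"]) (auto simp: fun_eq_iff)
  let ?g = "case_family F2 F0 F1"
  have "?g (?g (?g i)) = i" for i by (cases i) auto
  then show "bij ?g"
    by (intro o_bij[of "?g \<circ> ?g"]) (auto simp: fun_eq_iff)
  show "rot (reflect i k n) = reflect (?g i) k (rot n)" for i k n
    by (cases i; cases n; simp)
qed (auto simp: algebra_simps)

lemma symmetry_flip: "symmetry flip"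
  unfolding symmetry_def
proof (intro conjI exI allI)
  show "bij flip"
    by (rule o_bij[of flip]) (auto simp: fun_eq_iff)
  let ?g = "case_family F1 F0 F2"
  have "?g (?g i) = i" for i by (cases i) auto
  then show "bij ?g"
    by (intro o_bij[of ?g]) (auto simp: fun_eq_iff)
  show "flip (reflect i k n) = reflect (?g i) k (flip n)" for i k n
    by (cases i; cases n; simp)
qed (auto simp: algebra_simps)

lemma below_symmetry:
  assumes "symmetry f"
  shows "below (f m) (f n) \<longleftrightarrow> below m n"
proof -
  obtain g where f: "bij f" "\<And>n. f n \<in> triples \<longleftrightarrow> n \<in> triples" "\<And>n. len (f n) = len n"
    and g: "bij g" "\<And>i k n. f (reflect i k n) = reflect (g i) k (f n)"
    using assms unfolding symmetry_def by blast
  have step: "step (f m) (f n) \<longleftrightarrow> step m n" for m n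
  proof -
    have "(\<exists>i k. f n = reflect i k (f m)) \<longleftrightarrow> (\<exists>i k. f n = reflect (g i) k (f m))"
      using g(1) by (metis bij_pointE)
    also have "\<dots> \<longleftrightarrow> (\<exists>i k. n = reflect i k m)"
      unfolding g(2)[symmetric] using bij_is_inj[OF f(1)] by (auto dest: injD)
    finally show ?thesis unfolding step_def f by simp
  qed
  have "step\<^sup>*\<^sup>* m n \<Longrightarrow> step\<^sup>*\<^sup>* (f m) (f n)"
    by (induction rule: rtranclp_induct) (auto simp: step intro: rtranclp.rtrancl_into_rtrancl)
  moreover have "step\<^sup>*\<^sup>* (f m) n' \<Longrightarrow> \<exists>n. n' = f n \<and> step\<^sup>*\<^sup>* m n" for n'
  proof (induction rule: rtranclp_induct)
    case (step y z)
    obtain z' where "z = f z'" using f(1) by (metis bij_pointE)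
    then show ?case using step \<open>\<And>n m. step (f m) (f n) \<longleftrightarrow> step m n\<close>
      by (metis rtranclp.rtrancl_into_rtrancl)
  next
    case base
    show ?case by blast
  qed
  ultimately show ?thesis
    unfolding below_def f using bij_is_inj[OF f(1)] by (metis injD)
qed

lemma smooth_symmetry:
  assumes "symmetry f"
  shows "smooth (f w) \<longleftrightarrow> smooth w"
proof -
  obtain g where f: "bij f" "\<And>n. len (f n) = len n"
    and g: "bij g" "\<And>i k n. f (reflect i k n) = reflect (g i) k (f n)"
    using assms unfolding symmetry_def by blast
  have c: "card {(i, k). below (reflect i k (f y)) (f w)} = card {(i, k). below (reflect i k y) w}" for y
  proof -
    have "bij_betw (map_prod g id) {(i, k). below (reflect i k y) w}
        {(i, k). below (reflect i k (f y)) (f w)}"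
    proof (rule bij_betw_imageI)
      show "inj_on (map_prod g id) {(i, k). below (reflect i k y) w}"
        using bij_is_inj[OF g(1)] by (auto simp: inj_on_def dest: injD)
      have b: "below (reflect (g i) k (f y)) (f w) \<longleftrightarrow> below (reflect i k y) w" for i k
        using below_symmetry[OF assms] g(2) by metis
      show "map_prod g id ` {(i, k). below (reflect i k y) w} =
          {(i, k). below (reflect i k (f y)) (f w)}"
      proof (intro Set.set_eqI iffI)
        fix p assume "p \<in> {(i, k). below (reflect i k (f y)) (f w)}"
        then obtain i k where p: "p = (i, k)" "below (reflect i k (f y)) (f w)" by auto
        obtain j where "i = g j" using g(1) by (metis bij_pointE)
        then show "p \<in> map_prod g id ` {(i, k). below (reflect i k y) w}"
          using p b by (intro image_eqI[of _ _ "(j, k)"]) auto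
      qed (auto simp: b)
    qed
    then show ?thesis by (simp add: bij_betw_same_card)
  qed
  have "(\<forall>y. below y (f w) \<longrightarrow> P y) \<longleftrightarrow> (\<forall>y. below y w \<longrightarrow> P (f y))" for P
    using below_symmetry[OF assms] bij_is_surj[OF f(1)] unfolding surj_def by metis
  then show ?thesis
    unfolding smooth_def f(2) by (simp only: c)
qed

text \<open>The condition \<open>(a + b) \<bullet> v > 1\<close> is \<open>f_0 < 0\<close>, so an
  even chamber makes two of the three functions negative; dually, an odd chamber makes two of them
  exceed 1. In this form invariance under permutations is visible.\<close>

fun even_triple :: "triple \<Rightarrow> bool" where
  "even_triple (x, y, z) \<longleftrightarrow> x < 0 \<and> y < 0 \<or> y < 0 \<and> z < 0 \<or> z < 0 \<and> x < 0"

fun odd_triple :: "triple \<Rightarrow> bool" where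
  "odd_triple (x, y, z) \<longleftrightarrow> x > 0 \<and> y > 0 \<or> y > 0 \<and> z > 0 \<or> z > 0 \<and> x > 0"

text \<open>An even spiral such as \<open>(0, y, - y)\<close> after crossing the wall at which its
  zero coordinate drops to \<open>- 1\<close>.\<close>

fun twisted_triple :: "triple \<Rightarrow> bool" where
  "twisted_triple (x, y, z) \<longleftrightarrow>
     x = - 1 \<and> z = - y \<and> y \<noteq> 0 \<or> y = - 1 \<and> x = - z \<and> z \<noteq> 0 \<or> z = - 1 \<and> y = - x \<and> x \<noteq> 0"

definition classified_triple :: "triple \<Rightarrow> bool" where
  "classified_triple n \<longleftrightarrow> len n \<le> 3 \<or> (even_triple n \<and> len n = 4) \<or> (odd_triple n \<and> len n = 4) \<or>
     twisted_triple n"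

lemma classified_symmetry:
  "classified_triple (rot n) \<longleftrightarrow> classified_triple n"
  "classified_triple (flip n) \<longleftrightarrow> classified_triple n"
proof -
  obtain x y z where n: "n = (x, y, z)" by (cases n)
  have "len (rot n) = len n" "len (flip n) = len n" by (simp_all add: n add.commute add.left_commute)
  moreover have "even_triple (rot n) = even_triple n" "even_triple (flip n) = even_triple n"
      "odd_triple (rot n) = odd_triple n" "odd_triple (flip n) = odd_triple n"
    unfolding n by auto
  moreover have "twisted_triple (rot n) = twisted_triple n" "twisted_triple (flip n) = twisted_triple n"
    unfolding n rot.simps flip.simps twisted_triple.simps by (metis add.inverse_inverse neg_equal_0_iff_equal)+
  ultimately show "classified_triple (rot n) \<longleftrightarrow> classified_triple n"
      "classified_triple (flip n) \<longleftrightarrow> classified_triple n"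
    unfolding classified_triple_def by simp_all
qed

lemma smooth_iff_classified_sorted:
  assumes "(x, y, z) \<in> triples" "x \<le> y" "y \<le> z"
  shows "smooth (x, y, z) \<longleftrightarrow> classified_triple (x, y, z)"
proof -
  consider "y = 0" "x = - z" "z \<ge> 2" | "y = 0" "x = - z - 1" "z \<ge> 2" | "y = 0" "z \<le> 1"
    | "y \<ge> 1" "x = - y - z" "z \<ge> 2" | "y \<ge> 1" "x = - y - z - 1" "z \<ge> 2" | "y \<ge> 1" "z \<le> 1"
    | "y \<le> -1" "z = - x - y" "x \<le> -2" | "y = -1" "z = - x - y - 1"
    | "y \<le> -2" "z = - x - y - 1" | "y \<le> -1" "z = - x - y" "x = -1"
    using assms unfolding mem_triples by (smt (verit))
  then show ?thesis
  proof cases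
    case 1
    then show ?thesis
      using not_smooth_spiral_even[of z] by (auto simp: classified_triple_def)
  next
    case 2
    then show ?thesis
      using not_smooth_spiral_odd[of z] by (auto simp: classified_triple_def)
  next
    case 3
    have "z = 0 \<or> z = 1" "x = - z \<or> x = - z - 1"
      using 3 assms unfolding mem_triples by linarith+
    then show ?thesis
      using smooth_small 3 by (elim disjE) (simp_all add: classified_triple_def)
  next
    case 4
    then have "\<not> smooth (x, y, z)"
      using not_smooth_odd_up[of y z] by simp
    then show ?thesis
      using 4 assms by (auto simp: classified_triple_def)
  next
    case 5
    then have "\<not> smooth (x, y, z)"
      using not_smooth_odd_down[of y z] by simp
    then show ?thesis
      using 5 assms by (auto simp: classified_triple_def)
  next
    case 6
    have "y = 1" "z = 1" "x = - 2 \<or> x = - 3"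
      using 6 assms unfolding mem_triples by linarith+
    then show ?thesis
      using smooth_small not_smooth_odd_down_corner
      by (elim disjE) (simp_all add: classified_triple_def)
  next
    case 7
    then have "\<not> smooth (x, y, z)"
      using not_smooth_even_up[of "- x" "- y"] by simp
    then show ?thesis
      using 7 assms by (auto simp: classified_triple_def)
  next
    case 8
    \<comment> \<open>\<open>rot\<close> takes \<open>(x, - 1, - x)\<close> to
      \<open>(- 1, - x, x)\<close>, the twisted spiral of \<open>smooth_twisted\<close> with
      parameter \<open>- x\<close>.\<close>
    then have "smooth (x, y, z) \<longleftrightarrow> smooth (- 1, - x, x)"
      using smooth_symmetry[OF symmetry_rot, of "(x, y, z)"]
        smooth_symmetry[OF symmetry_rot, of "(- 1, - x, x)"]
        smooth_symmetry[OF symmetry_flip, of "(- 1, - x, x)"]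
        smooth_symmetry[OF symmetry_rot, of "(x, - 1, - x)"]
        smooth_symmetry[OF symmetry_rot, of "(- x, x, -1)"]
      by simp
    then show ?thesis
      using 8 assms smooth_twisted[of "- x"] by (auto simp: classified_triple_def)
  next
    case 9
    then have "\<not> smooth (x, y, z)"
      using not_smooth_even_down[of "- x" "- y"] assms(2) by simp
    then show ?thesis
      using 9 assms by (auto simp: classified_triple_def)
  next
    case 10
    have "x = - 1" "y = - 1" "z = 2"
      using 10 assms unfolding mem_triples by linarith+
    then show ?thesis
      using smooth_small by (simp add: classified_triple_def)
  qed
qed

lemma smooth_iff_classified:
  assumes "n \<in> triples"
  shows "smooth n \<longleftrightarrow> classified_triple n"
proof -
  obtain x y z where n: "n = (x, y, z)" by (cases n)
  let ?G = "\<lambda>n. smooth n \<longleftrightarrow> classified_triple n"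
  have R: "?G (x, y, z) \<longleftrightarrow> ?G (y, z, x)" and S: "?G (x, y, z) \<longleftrightarrow> ?G (y, x, z)" for x y z
    using smooth_symmetry[OF symmetry_rot, of "(x, y, z)"] classified_symmetry(1)[of "(x, y, z)"]
      smooth_symmetry[OF symmetry_flip, of "(x, y, z)"] classified_symmetry(2)[of "(x, y, z)"]
    by simp_all
  have sum: "x + y + z = 0 \<or> x + y + z = - 1" using assms n by simp
  consider "x \<le> y" "y \<le> z" | "x \<le> z" "z \<le> y" | "y \<le> x" "x \<le> z" | "y \<le> z" "z \<le> x"
    | "z \<le> x" "x \<le> y" | "z \<le> y" "y \<le> x"
    by linarith
  then show ?thesis
    unfolding n
  proof cases
    case 1
    then show "?G (x, y, z)" using smooth_iff_classified_sorted[of x y z] sum by simp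
  next
    case 2
    then have "?G (x, z, y)" using smooth_iff_classified_sorted[of x z y] sum by auto
    then show "?G (x, y, z)" using R S by blast
  next
    case 3
    then have "?G (y, x, z)" using smooth_iff_classified_sorted[of y x z] sum by auto
    then show "?G (x, y, z)" using S by blast
  next
    case 4
    then have "?G (y, z, x)" using smooth_iff_classified_sorted[of y z x] sum by auto
    then show "?G (x, y, z)" using R by blast
  next
    case 5
    then have "?G (z, x, y)" using smooth_iff_classified_sorted[of z x y] sum by auto
    then show "?G (x, y, z)" using R by blast
  next
    case 6
    then have "?G (z, y, x)" using smooth_iff_classified_sorted[of z y x] sum by auto
    then show "?G (x, y, z)" using R S by blast
  qed
qed

section \<open>The Weyl group as integer triples\<close>

locale A2_plane =
  fixes a b :: "'v::euclidean_space"
  assumes base: "A2_base a b"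
begin

lemma inner_ab [simp]: "a \<bullet> a = 2" "b \<bullet> b = 2" "a \<bullet> b = - 1" "b \<bullet> a = - 1"
  using base by (simp_all add: A2_base_def inner_commute)

text \<open>A nonzero vector orthogonal to both simple roots would complete an orthogonal basis of
  their span to three independent vectors, against dimension 2.\<close>

lemma plane_eqI:
  assumes "a \<bullet> u = a \<bullet> v" "b \<bullet> u = b \<bullet> v"
  shows "u = v"
proof (rule ccontr)
  assume "u \<noteq> v"
  \<comment> \<open>Twice the component of \<open>b\<close> orthogonal to \<open>a\<close>.\<close>
  define c where "c = 2 *\<^sub>R b + a"
  define d where "d = u - v"
  have c: "c \<bullet> a = 0" "a \<bullet> c = 0" "c \<bullet> c = 6"
    by (simp_all add: c_def inner_simps)
  have d: "a \<bullet> d = 0" "d \<bullet> a = 0" "c \<bullet> d = 0" "d \<bullet> c = 0" "d \<noteq> 0"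
    using assms \<open>u \<noteq> v\<close> by (simp_all add: c_def d_def inner_simps inner_commute)
  have nz: "a \<noteq> 0" "c \<noteq> 0"
    using inner_ab(1) c(3) by (metis inner_zero_left zero_neq_numeral)+
  have "a \<noteq> c" "a \<noteq> d" "c \<noteq> d" using c d nz by auto
  moreover have "independent {a, c, d}"
    by (rule pairwise_orthogonal_independent)
      (use c d nz in \<open>auto simp: pairwise_def orthogonal_def\<close>)
  ultimately have "3 \<le> DIM('v)"
    using independent_bound[of "{a, c, d}"] by simp
  then show False using base by (simp add: A2_base_def)
qed

text \<open>Barycentric coordinates with respect to the vertices of the fundamental alcove.\<close>

definition bary :: "'v \<Rightarrow> real \<times> real \<times> real" where
  "bary v = (1 - (a + b) \<bullet> v, a \<bullet> v, b \<bullet> v)"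

lemma bary_inject [simp]: "bary u = bary v \<longleftrightarrow> u = v"
  using plane_eqI by (auto simp: bary_def)

lemma bary_sum: "bary v = (p, q, r) \<Longrightarrow> p + q + r = 1"
  by (auto simp: bary_def inner_simps)

lemma bary_surj: "p + q + r = 1 \<Longrightarrow> \<exists>v. bary v = (p, q, r)"
  \<comment> \<open>The combination \<open>q * u + r * v\<close> of the fundamental weights
    \<open>u = (2 a + b) / 3\<close> and \<open>v = (a + 2 b) / 3\<close>.\<close>
  by (rule exI[of _ "((2 * q + r) / 3) *\<^sub>R a + ((q + 2 * r) / 3) *\<^sub>R b"])
    (auto simp: bary_def inner_simps field_simps)

text \<open>The index \<open>1 - k\<close> comes from \<open>f_0 = 1 - (a + b) \<bullet> v\<close>.
  With this convention the simple reflections are uniformly \<open>wall i 0\<close>.\<close>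

fun wall :: "family \<Rightarrow> int \<Rightarrow> 'v \<Rightarrow> 'v" where
  "wall F0 k = affine_refl (a + b) (1 - k)"
| "wall F1 k = affine_refl a k"
| "wall F2 k = affine_refl b k"

lemma reflections_eq: "reflections a b = {wall i k | i k. True}"
proof -
  have neg: "affine_refl (- \<gamma>) k = affine_refl \<gamma> (- k)" for \<gamma> :: 'v and k
  proof
    fix v
    have "2 * (- \<gamma> \<bullet> v - of_int k) = - (2 * (\<gamma> \<bullet> v - of_int (- k)))" by simp
    then show "affine_refl (- \<gamma>) k v = affine_refl \<gamma> (- k) v"
      unfolding affine_refl_def
      by (simp only: minus_divide_left[symmetric] scaleR_minus_left scaleR_minus_right
        inner_minus_left inner_minus_right minus_minus)
  qed
  have walls: "\<exists>i j. affine_refl \<gamma> k = wall i j" if "\<gamma> \<in> {a, b, a + b}" for \<gamma> k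
  proof -
    have "affine_refl a k = wall F1 k" "affine_refl b k = wall F2 k"
      "affine_refl (a + b) k = wall F0 (1 - k)" by simp_all
    then show ?thesis using that by (elim insertE emptyE) metis+
  qed
  have "\<exists>i j. affine_refl \<gamma> k = wall i j" if "\<gamma> \<in> roots a b" for \<gamma> k
  proof (cases "\<gamma> \<in> {a, b, a + b}")
    case True
    then show ?thesis by (rule walls)
  next
    case False
    then have "- \<gamma> \<in> {a, b, a + b}" using that by (auto simp: roots_def)
    moreover have "affine_refl \<gamma> k = affine_refl (- \<gamma>) (- k)" using neg[of "- \<gamma>" k] by simp
    ultimately show ?thesis using walls by metis
  qed
  moreover have "wall i k \<in> reflections a b" for i k
    by (cases i) (auto simp: reflections_def roots_def)
  ultimately show ?thesis
    unfolding reflections_def by auto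
qed

fun bary_reflect :: "family \<Rightarrow> int \<Rightarrow> real \<times> real \<times> real \<Rightarrow> real \<times> real \<times> real" where
  "bary_reflect F0 k (p, q, r) = (2 * of_int k - p, 1 - r - of_int k, 1 - q - of_int k)"
| "bary_reflect F1 k (p, q, r) = (1 - r - of_int k, 2 * of_int k - q, 1 - p - of_int k)"
| "bary_reflect F2 k (p, q, r) = (1 - q - of_int k, 1 - p - of_int k, 2 * of_int k - r)"

lemma bary_wall: "bary (wall i k v) = bary_reflect i k (bary v)"
  by (cases i) (auto simp: bary_def affine_refl_def inner_simps field_simps)

text \<open>The Weyl group preserves \<open>f\<^sub>1 - f\<^sub>2\<close> modulo \<open>3\<close> on the vertices of the alcoves.  Hence the residue
  of \<open>y - z\<close> determines how the linear part permutes the coordinates, and the triple determines the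
  group element.\<close>

definition act :: "triple \<Rightarrow> real \<times> real \<times> real \<Rightarrow> real \<times> real \<times> real" where
  "act = (\<lambda>(x, y, z) (p, q, r).
     if x + y + z = 0 then
       if (y - z) mod 3 = 0 then (x + p, y + q, z + r)
       else if (y - z) mod 3 = 1 then (x + q, y + r, z + p)
       else (x + r, y + p, z + q)
     else
       if (y - z) mod 3 = 0 then (x + 1 - p, y + 1 - r, z + 1 - q)
       else if (y - z) mod 3 = 1 then (x + 1 - q, y + 1 - p, z + 1 - r)
       else (x + 1 - r, y + 1 - q, z + 1 - p))"

lemma act_reflect:
  assumes "n \<in> triples"
  shows "act (reflect i k n) P = bary_reflect i k (act n P)"
proof -
  obtain x y z where n: "n = (x, y, z)" by (cases n)
  obtain p q r where P: "P = (p, q, r)" by (cases P)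
  have s: "x = - y - z \<or> x = - y - z - 1" using assms n by auto
  \<comment> \<open>\<open>F0\<close> preserves \<open>y - z\<close>; its values after
    \<open>F1\<close> and \<open>F2\<close> are \<open>?u1\<close> and \<open>?u2\<close>. In these
    \<open>k\<close> has coefficient 3 or -3, so their residues depend only on that of
    \<open>y - z\<close> and on the coordinate sum.\<close>
  have F0: "- z - k - (- y - k) = y - z" by simp
  let ?u1 = "2 * k - 1 - y - (- x - k)" and ?u2 = "- x - k - (2 * k - 1 - z)"
  consider "(y - z) mod 3 = 0" | "(y - z) mod 3 = 1" | "(y - z) mod 3 \<noteq> 0" "(y - z) mod 3 \<noteq> 1"
    by blast
  then show ?thesis
  proof cases
    case 1
    from s show ?thesis
    proof
      assume x: "x = - y - z"
      have "?u1 mod 3 = 2" "?u2 mod 3 = 1" using x 1 by presburger+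
      then show ?thesis using 1
        by (cases i; simp only: n P act_def reflect.simps case_prod_conv F0) (auto simp: x)
    next
      assume x: "x = - y - z - 1"
      have "?u1 mod 3 = 1" "?u2 mod 3 = 2" using x 1 by presburger+
      then show ?thesis using 1
        by (cases i; simp only: n P act_def reflect.simps case_prod_conv F0) (auto simp: x)
    qed
  next
    case 2
    from s show ?thesis
    proof
      assume x: "x = - y - z"
      have "?u1 mod 3 = 0" "?u2 mod 3 = 2" using x 2 by presburger+
      then show ?thesis using 2
        by (cases i; simp only: n P act_def reflect.simps case_prod_conv F0) (auto simp: x)
    next
      assume x: "x = - y - z - 1"
      have "?u1 mod 3 = 2" "?u2 mod 3 = 0" using x 2 by presburger+
      then show ?thesis using 2
        by (cases i; simp only: n P act_def reflect.simps case_prod_conv F0) (auto simp: x)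
    qed
  next
    case 3
    from s show ?thesis
    proof
      assume x: "x = - y - z"
      have "?u1 mod 3 = 1" "?u2 mod 3 = 0" using x 3 by presburger+
      then show ?thesis using 3
        by (cases i; simp only: n P act_def reflect.simps case_prod_conv F0) (auto simp: x)
    next
      assume x: "x = - y - z - 1"
      have "?u1 mod 3 = 0" "?u2 mod 3 = 1" using x 3 by presburger+
      then show ?thesis using 3
        by (cases i; simp only: n P act_def reflect.simps case_prod_conv F0) (auto simp: x)
    qed
  qed
qed

definition models :: "('v \<Rightarrow> 'v) \<Rightarrow> triple \<Rightarrow> bool" where
  "models w n \<longleftrightarrow> n \<in> triples \<and> (\<forall>v. bary (w v) = act n (bary v))"

lemma models_id: "models id (0, 0, 0)"
  by (auto simp: models_def act_def split: prod.split)

lemma models_wall: "models w n \<Longrightarrow> models (wall i k \<circ> w) (reflect i k n)"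
  by (simp add: models_def bary_wall act_reflect)

lemma models_inject: "models w n \<Longrightarrow> models w' n \<Longrightarrow> w = w'"
  unfolding models_def fun_eq_iff by (metis bary_inject)

lemma models_unique:
  assumes "models w m" "models w n"
  shows "m = n"
proof -
  \<comment> \<open>The permutations in \<open>act\<close> fix the centroid. Its image is the triple
    shifted by 1/3 or by 2/3 in every coordinate, so the fractional part reveals the sum and the
    integer part the triple.\<close>
  obtain c where c: "bary c = (1/3, 1/3, 1/3)" using bary_surj[of "1/3" "1/3" "1/3"] by auto
  have frac: "of_int x + 1/3 \<noteq> of_int y + 1 - (1/3::real)" for x y :: int
  proof
    assume "of_int x + 1/3 = of_int y + 1 - (1/3::real)"
    then have "3 * x + 1 = 3 * y + 2" by linarith
    then show False by presburger
  qed
  have "act m (bary c) = act n (bary c)" using assms by (metis models_def)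
  then show ?thesis using frac frac[symmetric]
    by (cases m; cases n) (auto simp: c act_def split: if_splits)
qed

lemma weyl_models: "w \<in> weyl a b \<Longrightarrow> \<exists>n. models w n"
proof (induction rule: weyl.induct)
  case one
  show ?case using models_id by blast
next
  case (refl r x)
  then show ?case unfolding reflections_eq using models_wall by fastforce
qed

definition tri :: "('v \<Rightarrow> 'v) \<Rightarrow> triple" where
  "tri w = (THE n. models w n)"

lemma tri_eqI: "models w n \<Longrightarrow> tri w = n"
  unfolding tri_def using models_unique by blast

lemma models_tri: "w \<in> weyl a b \<Longrightarrow> models w (tri w)"
  using weyl_models tri_eqI by metis

lemma tri_triples: "w \<in> weyl a b \<Longrightarrow> tri w \<in> triples"
  using models_tri models_def by blast

lemma tri_inject: "x \<in> weyl a b \<Longrightarrow> y \<in> weyl a b \<Longrightarrow> tri x = tri y \<longleftrightarrow> x = y"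
  using models_tri models_inject by metis

lemma tri_id: "tri id = (0, 0, 0)"
  by (rule tri_eqI[OF models_id])

lemma wall_weyl: "w \<in> weyl a b \<Longrightarrow> wall i k \<circ> w \<in> weyl a b"
  by (rule weyl.refl) (auto simp: reflections_eq)

lemma tri_wall: "w \<in> weyl a b \<Longrightarrow> tri (wall i k \<circ> w) = reflect i k (tri w)"
  using models_tri models_wall tri_eqI by blast

section \<open>Words, length and Bruhat order\<close>

definition ix :: "nat \<Rightarrow> family" where
  "ix i = (if i = 0 then F0 else if i = 1 then F1 else F2)"

lemma simple_refl_eq: "simple_refl a b i = wall (ix i) 0"
  by (simp add: simple_refl_def ix_def)

lemma word_val_Nil: "word_val a b [] = id"
  by (simp add: word_val_def)

lemma word_val_Cons: "word_val a b (i # is) = wall (ix i) 0 \<circ> word_val a b is"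
  by (simp add: word_val_def simple_refl_eq)

lemma word_val_weyl: "word_val a b is \<in> weyl a b"
proof (induction "is")
  case Nil
  show ?case unfolding word_val_Nil by (rule weyl.one)
qed (simp only: word_val_Cons wall_weyl)

lemma tri_word_val: "tri (word_val a b is) = foldr (\<lambda>i. reflect (ix i) 0) is (0, 0, 0)"
proof (induction "is")
  case Nil
  show ?case unfolding word_val_Nil tri_id by simp
next
  case (Cons i "is")
  have "tri (word_val a b (i # is)) = reflect (ix i) 0 (tri (word_val a b is))"
    unfolding word_val_Cons by (rule tri_wall[OF word_val_weyl])
  then show ?case by (simp add: Cons.IH)
qed

lemma len_reflect_simple: "len (reflect i 0 n) \<le> Suc (len n)"
  by (cases n; cases i) auto

lemma len_tri_word_val: "len (tri (word_val a b is)) \<le> length is"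
proof (induction "is")
  case Nil
  then show ?case by (simp add: tri_word_val)
next
  case (Cons i "is")
  then show ?case
    using len_reflect_simple[of "ix i" "tri (word_val a b is)"]
    unfolding word_val_Cons tri_wall[OF word_val_weyl] by simp
qed

text \<open>Coordinates of sum 0 or -1 that are not all zero include a negative one. Then a line
  \<open>f_i = 0\<close> separates, and its simple reflection shortens the element.\<close>

lemma triples_word: "n \<in> triples \<Longrightarrow> \<exists>is \<in> words. length is = len n \<and> tri (word_val a b is) = n"
proof (induction "len n" arbitrary: n rule: less_induct)
  case less
  show ?case
  proof (cases "n = (0, 0, 0)")
    case True
    then show ?thesis by (intro bexI[of _ "[]"]) (simp_all add: words_def tri_word_val)
  next
    case False
    then have "coord F0 n < 0 \<or> coord F1 n < 0 \<or> coord F2 n < 0"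
      using less.prems by (cases n) auto
    then have "\<exists>i \<in> {0, 1, 2}. coord (ix i) n < 0"
      by (auto simp: ix_def)
    then obtain i where i: "i \<in> {0, 1, 2}" "coord (ix i) n < 0" by blast
    then have *: "len (reflect (ix i) 0 n) < len n"
      using less.prems by (simp add: len_reflect sep_def)
    then obtain "is" where "is": "is \<in> words" "length is = len (reflect (ix i) 0 n)"
        "tri (word_val a b is) = reflect (ix i) 0 n"
      using less.hyps[of "reflect (ix i) 0 n"] less.prems by auto
    have "len n \<le> Suc (len (reflect (ix i) 0 n))"
      using len_reflect_simple[of "ix i" "reflect (ix i) 0 n"] by simp
    with * have "length (i # is) = len n" using "is" by simp
    moreover have "i # is \<in> words" using i "is" by (auto simp: words_def)
    moreover have "tri (word_val a b (i # is)) = n"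
      unfolding word_val_Cons tri_wall[OF word_val_weyl] "is" by simp
    ultimately show ?thesis by blast
  qed
qed

lemma tri_surj: "n \<in> triples \<Longrightarrow> \<exists>w \<in> weyl a b. tri w = n"
  using triples_word word_val_weyl by blast

lemma weyl_word: "w \<in> weyl a b \<Longrightarrow> \<exists>is \<in> words. word_val a b is = w"
  using triples_word tri_triples tri_inject word_val_weyl by metis

lemma weyl_length_eq:
  assumes "w \<in> weyl a b"
  shows "weyl_length a b w = len (tri w)"
  unfolding weyl_length_def
proof (rule Least_equality)
  obtain "is" where "is": "is \<in> words" "length is = len (tri w)" "tri (word_val a b is) = tri w"
    using triples_word[OF tri_triples[OF assms]] by blast
  then show "\<exists>is\<in>words. length is = len (tri w) \<and> word_val a b is = w"
    using tri_inject[OF word_val_weyl assms] by blast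
next
  fix m assume "\<exists>is\<in>words. length is = m \<and> word_val a b is = w"
  then show "len (tri w) \<le> m" using len_tri_word_val by blast
qed

lemma bruhat_step_iff:
  assumes "x \<in> weyl a b" "y \<in> weyl a b"
  shows "bruhat_step a b x y \<longleftrightarrow> step (tri x) (tri y)"
proof -
  have "y = wall i k \<circ> x \<longleftrightarrow> tri y = reflect i k (tri x)" for i k
    using tri_inject[OF assms(2) wall_weyl[OF assms(1)]] tri_wall[OF assms(1)] by metis
  then show ?thesis
    using assms tri_triples
    by (auto simp: bruhat_step_def step_def weyl_length_eq reflections_eq)
qed

lemma bruhat_step_weyl: "bruhat_step a b x y \<Longrightarrow> x \<in> weyl a b \<and> y \<in> weyl a b"
  unfolding bruhat_step_def using weyl.refl by blast

lemma bruhat_le_iff: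
  "bruhat_le a b x y \<longleftrightarrow> x \<in> weyl a b \<and> y \<in> weyl a b \<and> below (tri x) (tri y)"
proof -
  have "step\<^sup>*\<^sup>* (tri x) (tri y)" if "(bruhat_step a b)\<^sup>*\<^sup>* x y"
    using that
  proof (induction rule: rtranclp_induct)
    case (step y z)
    then show ?case
      using bruhat_step_iff bruhat_step_weyl by (meson rtranclp.rtrancl_into_rtrancl)
  qed simp
  moreover have "(bruhat_step a b)\<^sup>*\<^sup>* x y"
    if "x \<in> weyl a b" "y \<in> weyl a b" "step\<^sup>*\<^sup>* (tri x) (tri y)"
  proof -
    have "step\<^sup>*\<^sup>* (tri x) n \<Longrightarrow> \<exists>y \<in> weyl a b. tri y = n \<and> (bruhat_step a b)\<^sup>*\<^sup>* x y" for n
    proof (induction rule: rtranclp_induct)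
      case base
      then show ?case using that(1) by blast
    next
      case (step m n)
      then obtain y where y: "y \<in> weyl a b" "tri y = m" "(bruhat_step a b)\<^sup>*\<^sup>* x y" by blast
      obtain z where z: "z \<in> weyl a b" "tri z = n"
        using step.hyps(2) tri_surj[of n] unfolding step_def by auto
      then have "bruhat_step a b y z" using y step.hyps(2) bruhat_step_iff by blast
      then show ?case using y z by (auto intro: rtranclp.rtrancl_into_rtrancl)
    qed
    then show ?thesis using that tri_inject by blast
  qed
  ultimately show ?thesis
    using tri_triples unfolding bruhat_le_def below_def by blast
qed

lemma cp_condition_iff:
  assumes "w \<in> weyl a b"
  shows "(\<forall>x. bruhat_le a b x w \<longrightarrow> cp_condition a b w x) \<longleftrightarrow> smooth (tri w)"
proof -
  have "card {r \<in> reflections a b. bruhat_le a b (r \<circ> y) w} =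
      card {(i, k). below (reflect i k (tri y)) (tri w)}" if "y \<in> weyl a b" for y
  proof -
    have inj: "wall i k = wall j l \<longleftrightarrow> i = j \<and> k = l" for i k j l
    proof
      assume "wall i k = wall j l"
      then have "reflect i k (tri id) = reflect j l (tri id)"
        using tri_wall[OF weyl.one] by metis
      then show "i = j \<and> k = l" using reflect_inject[OF tri_triples[OF weyl.one]] by blast
    qed simp
    have "bij_betw (\<lambda>(i, k). wall i k) {(i, k). below (reflect i k (tri y)) (tri w)}
      {r \<in> reflections a b. bruhat_le a b (r \<circ> y) w}"
      by (rule bij_betw_imageI)
        (use that assms in \<open>auto simp: inj_on_def inj reflections_eq bruhat_le_iff wall_weyl tri_wall\<close>)
    then show ?thesis by (simp add: bij_betw_same_card)
  qed
  then have "(\<forall>x. bruhat_le a b x w \<longrightarrow> cp_condition a b w x) \<longleftrightarrow>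
      (\<forall>x y. bruhat_le a b x w \<and> bruhat_le a b x y \<and> bruhat_le a b y w \<longrightarrow>
         card {(i, k). below (reflect i k (tri y)) (tri w)} = len (tri w))"
    unfolding cp_condition_def weyl_length_eq[OF assms] bruhat_le_iff by auto
  \<comment> \<open>The element \<open>x\<close> only bounds \<open>y\<close> from below, and
    \<open>x = y\<close> is a possible choice.\<close>
  also have "\<dots> \<longleftrightarrow> (\<forall>y. bruhat_le a b y w \<longrightarrow>
         card {(i, k). below (reflect i k (tri y)) (tri w)} = len (tri w))"
    using bruhat_le_iff tri_triples below_refl by blast
  also have "\<dots> \<longleftrightarrow> smooth (tri w)"
    unfolding smooth_def
  proof (intro iffI allI impI)
    fix n
    assume *: "\<forall>y. bruhat_le a b y w \<longrightarrow>
         card {(i, k). below (reflect i k (tri y)) (tri w)} = len (tri w)" and n: "below n (tri w)"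
    then obtain y where "y \<in> weyl a b" "tri y = n"
      using tri_surj unfolding below_def by blast
    then show "card {(i, k). below (reflect i k n) (tri w)} = len (tri w)"
      using * n assms bruhat_le_iff by blast
  qed (use bruhat_le_iff in blast)
  finally show ?thesis .
qed

end

section \<open>Alcoves, strips and chambers\<close>

context A2_plane
begin

definition open_cell :: "triple \<Rightarrow> (real \<times> real \<times> real) set" where
  "open_cell = (\<lambda>(x, y, z). {(p, q, r). x < p \<and> p < x + 1 \<and> y < q \<and> q < y + 1 \<and> z < r \<and> r < z + 1})"

definition closed_cell :: "triple \<Rightarrow> (real \<times> real \<times> real) set" where
  "closed_cell = (\<lambda>(x, y, z). {(p, q, r). x \<le> p \<and> p \<le> x + 1 \<and> y \<le> q \<and> q \<le> y + 1 \<and> z \<le> r \<and> r \<le> z + 1})"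

lemma fund_alcove_eq: "fund_alcove a b = {v. bary v \<in> open_cell (0, 0, 0)}"
  by (auto simp: fund_alcove_def bary_def open_cell_def inner_simps inner_commute)

lemma act_open_cell: "P \<in> open_cell (0, 0, 0) \<Longrightarrow> act n P \<in> open_cell n"
  by (cases n; cases P) (auto simp: open_cell_def act_def)

text \<open>In each branch of \<open>act\<close> the witnesses undo the permutation together with
  the translation or sign change.\<close>

lemma act_surj:
  assumes "n \<in> triples" "Q \<in> open_cell n" "Q = (p', q', r')" "p' + q' + r' = 1"
  shows "\<exists>p q r. p + q + r = 1 \<and> (p, q, r) \<in> open_cell (0, 0, 0) \<and> act n (p, q, r) = Q"
proof -
  obtain x y z where n: "n = (x, y, z)" by (cases n)
  have s: "x + y + z = 0 \<or> x + y + z = - 1" using assms n by simp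
  have c: "real_of_int x < p'" "p' < x + 1" "real_of_int y < q'" "q' < y + 1"
      "real_of_int z < r'" "r' < z + 1"
    using assms(2,3) by (simp_all add: n open_cell_def)
  consider "(y - z) mod 3 = 0" | "(y - z) mod 3 = 1" | "(y - z) mod 3 \<noteq> 0" "(y - z) mod 3 \<noteq> 1"
    by blast
  then show ?thesis
  proof cases
    case 1
    from s show ?thesis
    proof
      assume s: "x + y + z = 0"
      then have "real_of_int x + y + z = 0" by (simp flip: of_int_add)
      then show ?thesis using 1 s c assms(3,4)
        by (intro exI[of _ "p' - x"] exI[of _ "q' - y"] exI[of _ "r' - z"])
          (simp add: n act_def open_cell_def)
    next
      assume s: "x + y + z = - 1"
      then have "real_of_int x + y + z = - 1" by (simp flip: of_int_add)
      then show ?thesis using 1 s c assms(3,4)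
        by (intro exI[of _ "x + 1 - p'"] exI[of _ "z + 1 - r'"] exI[of _ "y + 1 - q'"])
          (simp add: n act_def open_cell_def)
    qed
  next
    case 2
    from s show ?thesis
    proof
      assume s: "x + y + z = 0"
      then have "real_of_int x + y + z = 0" by (simp flip: of_int_add)
      then show ?thesis using 2 s c assms(3,4)
        by (intro exI[of _ "r' - z"] exI[of _ "p' - x"] exI[of _ "q' - y"])
          (simp add: n act_def open_cell_def)
    next
      assume s: "x + y + z = - 1"
      then have "real_of_int x + y + z = - 1" by (simp flip: of_int_add)
      then show ?thesis using 2 s c assms(3,4)
        by (intro exI[of _ "y + 1 - q'"] exI[of _ "x + 1 - p'"] exI[of _ "z + 1 - r'"])
          (simp add: n act_def open_cell_def)
    qed
  next
    case 3
    from s show ?thesis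
    proof
      assume s: "x + y + z = 0"
      then have "real_of_int x + y + z = 0" by (simp flip: of_int_add)
      then show ?thesis using 3 s c assms(3,4)
        by (intro exI[of _ "q' - y"] exI[of _ "r' - z"] exI[of _ "p' - x"])
          (simp add: n act_def open_cell_def)
    next
      assume s: "x + y + z = - 1"
      then have "real_of_int x + y + z = - 1" by (simp flip: of_int_add)
      then show ?thesis using 3 s c assms(3,4)
        by (intro exI[of _ "z + 1 - r'"] exI[of _ "y + 1 - q'"] exI[of _ "x + 1 - p'"])
          (simp add: n act_def open_cell_def)
    qed
  qed
qed

lemma alcove_eq:
  assumes "models w n"
  shows "alcove a b w = {v. bary v \<in> open_cell n}"
proof
  show "alcove a b w \<subseteq> {v. bary v \<in> open_cell n}"
  proof
    fix v assume "v \<in> alcove a b w"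
    then obtain u where "v = w u" "bary u \<in> open_cell (0, 0, 0)"
      unfolding alcove_def fund_alcove_eq by blast
    then show "v \<in> {v. bary v \<in> open_cell n}"
      using assms act_open_cell[of "bary u" n] by (simp add: models_def)
  qed
  show "{v. bary v \<in> open_cell n} \<subseteq> alcove a b w"
  proof
    fix v assume "v \<in> {v. bary v \<in> open_cell n}"
    then have v: "bary v \<in> open_cell n" by simp
    obtain p' q' r' where P: "bary v = (p', q', r')" by (cases "bary v")
    have "n \<in> triples" using assms models_def by blast
    from act_surj[OF this v P bary_sum[OF P]] obtain p q r where
      pqr: "p + q + r = 1" "(p, q, r) \<in> open_cell (0, 0, 0)" "act n (p, q, r) = bary v" by blast
    obtain u where u: "bary u = (p, q, r)" using bary_surj pqr(1) by blast
    then have "w u = v" using assms pqr(3) by (metis models_def bary_inject)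
    moreover have "u \<in> fund_alcove a b" using u pqr(2) by (simp add: fund_alcove_eq)
    ultimately show "v \<in> alcove a b w" unfolding alcove_def by blast
  qed
qed

lemma center_in_cell:
  assumes "n \<in> triples"
  shows "\<exists>v. bary v \<in> open_cell n"
proof -
  obtain x y z where n: "n = (x, y, z)" by (cases n)
  have "x + y + z = 0 \<or> x + y + z = - 1" using assms n by simp
  then show ?thesis
  proof
    assume "x + y + z = 0"
    then have "(x + 1/3) + (y + 1/3) + (z + 1/3) = (1::real)" by (simp flip: of_int_add)
    then obtain v where "bary v = (x + 1/3, y + 1/3, z + 1/3)" using bary_surj by blast
    then show ?thesis by (intro exI[of _ v]) (simp add: n open_cell_def)
  next
    assume "x + y + z = - 1"
    then have "(x + 2/3) + (y + 2/3) + (z + 2/3) = (1::real)" by (simp flip: of_int_add)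
    then obtain v where "bary v = (x + 2/3, y + 2/3, z + 2/3)" using bary_surj by blast
    then show ?thesis by (intro exI[of _ v]) (simp add: n open_cell_def)
  qed
qed

lemma continuous_on_bary: "continuous_on S bary"
  unfolding bary_def by (intro continuous_intros)

lemma closed_closed_cell: "closed {v. bary v \<in> closed_cell n}"
proof -
  obtain x y z where n: "n = (x, y, z)" by (cases n)
  have "closed_cell n = {x..x + 1} \<times> {y..y + 1} \<times> {real_of_int z..z + 1}"
    by (auto simp: closed_cell_def n)
  then have "closed (bary -` closed_cell n)"
    using continuous_on_bary by (auto intro!: closed_vimage closed_Times)
  then show ?thesis by (simp add: vimage_def)
qed

lemma bary_affine:
  assumes "bary u = (p, q, r)" "bary v = (p', q', r')"
  shows "bary ((1 - t) *\<^sub>R u + t *\<^sub>R v) =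
    ((1 - t) * p + t * p', (1 - t) * q + t * q', (1 - t) * r + t * r')"
proof -
  have eq: "p = 1 - (a + b) \<bullet> u" "q = a \<bullet> u" "r = b \<bullet> u"
    "p' = 1 - (a + b) \<bullet> v" "q' = a \<bullet> v" "r' = b \<bullet> v"
    using assms by (auto simp: bary_def)
  show ?thesis unfolding eq by (simp add: bary_def inner_simps algebra_simps)
qed

text \<open>On the segment from a point of the closed cell to an interior point \<open>c\<close>,
  everything but the starting point satisfies the strict inequalities; letting the points approach
  the start gives the limit.\<close>

lemma closure_alcove:
  assumes "models w n"
  shows "closure (alcove a b w) = {v. bary v \<in> closed_cell n}"
proof
  have "alcove a b w \<subseteq> {v. bary v \<in> closed_cell n}"
    unfolding alcove_eq[OF assms] by (cases n) (auto simp: open_cell_def closed_cell_def)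
  then show "closure (alcove a b w) \<subseteq> {v. bary v \<in> closed_cell n}"
    using closed_closed_cell by (rule closure_minimal)
next
  obtain x y z where n: "n = (x, y, z)" by (cases n)
  obtain c where c: "bary c \<in> open_cell n"
    using center_in_cell assms models_def by blast
  obtain p q r where P: "bary c = (p, q, r)" by (cases "bary c")
  show "{v. bary v \<in> closed_cell n} \<subseteq> closure (alcove a b w)"
  proof
    fix v assume "v \<in> {v. bary v \<in> closed_cell n}"
    then have v: "bary v \<in> closed_cell n" by simp
    obtain p' q' r' where Q: "bary v = (p', q', r')" by (cases "bary v")
    have strict: "l < (1 - t) * g + t * h" "(1 - t) * g + t * h < m"
      if "0 < t" "t \<le> 1" "l \<le> g" "g \<le> m" "l < h" "h < m" for l m g h t :: real
    proof -
      have "(1 - t) * l \<le> (1 - t) * g" "t * l < t * h" "(1 - t) * g \<le> (1 - t) * m" "t * h < t * m"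
        using that by (auto intro: mult_left_mono)
      then show "l < (1 - t) * g + t * h" "(1 - t) * g + t * h < m"
        by (simp_all add: algebra_simps)
    qed
    have mem: "(1 - t) *\<^sub>R v + t *\<^sub>R c \<in> alcove a b w" if "0 < t" "t \<le> 1" for t
    proof -
      have "real_of_int x \<le> p'" "p' \<le> x + 1" "real_of_int y \<le> q'" "q' \<le> y + 1"
          "real_of_int z \<le> r'" "r' \<le> z + 1" "real_of_int x < p" "p < x + 1"
          "real_of_int y < q" "q < y + 1" "real_of_int z < r" "r < z + 1"
        using c v unfolding n P Q by (simp_all add: open_cell_def closed_cell_def)
      then show ?thesis
        unfolding alcove_eq[OF assms] mem_Collect_eq bary_affine[OF Q P] n open_cell_def
        by (simp add: strict that)
    qed
    define f where "f k = (1 - 1 / real (Suc k)) *\<^sub>R v + (1 / real (Suc k)) *\<^sub>R c" for k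
    have "f k \<in> alcove a b w" for k
      unfolding f_def by (rule mem) simp_all
    moreover have "f \<longlonglongrightarrow> (1 - 0) *\<^sub>R v + 0 *\<^sub>R c"
      unfolding f_def by (intro tendsto_intros LIMSEQ_inverse_real_of_nat[unfolded inverse_eq_divide])
    ultimately show "v \<in> closure (alcove a b w)"
      unfolding closure_sequential by auto
  qed
qed

text \<open>An alcove lies strictly between two consecutive integer levels of \<open>f\<close>, so a
  single point of it decides each inclusion.\<close>

lemma slab_cases:
  fixes f :: "'v \<Rightarrow> real"
  assumes "c \<in> A" "\<And>v. v \<in> A \<Longrightarrow> of_int k < f v \<and> f v < of_int k + 1"
  shows "A \<subseteq> {v. 0 \<le> f v \<and> f v \<le> 1} \<longleftrightarrow> k = 0"
    and "A \<subseteq> {v. f v < 0} \<longleftrightarrow> k < 0"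
    and "A \<subseteq> {v. f v > 1} \<longleftrightarrow> k > 0"
proof -
  have c: "of_int k < f c" "f c < of_int k + 1" using assms by auto
  show "A \<subseteq> {v. 0 \<le> f v \<and> f v \<le> 1} \<longleftrightarrow> k = 0"
  proof
    assume "A \<subseteq> {v. 0 \<le> f v \<and> f v \<le> 1}"
    then have "0 \<le> f c" "f c \<le> 1" using assms(1) by auto
    then have "real_of_int k < 1" "- 1 < real_of_int k" using c by linarith+
    then show "k = 0" by linarith
  next
    assume "k = 0"
    then show "A \<subseteq> {v. 0 \<le> f v \<and> f v \<le> 1}" using assms(2) by force
  qed
  show "A \<subseteq> {v. f v < 0} \<longleftrightarrow> k < 0"
  proof
    assume "A \<subseteq> {v. f v < 0}"
    then have "f c < 0" using assms(1) by auto
    then show "k < 0" using c by linarith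
  next
    assume "k < 0"
    then have "f v < 0" if "v \<in> A" for v using assms(2)[OF that] by linarith
    then show "A \<subseteq> {v. f v < 0}" by blast
  qed
  show "A \<subseteq> {v. f v > 1} \<longleftrightarrow> k > 0"
  proof
    assume "A \<subseteq> {v. f v > 1}"
    then have "f c > 1" using assms(1) by auto
    then show "k > 0" using c by linarith
  next
    assume "k > 0"
    then have "f v > 1" if "v \<in> A" for v using assms(2)[OF that] by linarith
    then show "A \<subseteq> {v. f v > 1}" by blast
  qed
qed

lemma alcove_slabs:
  assumes "w \<in> weyl a b" "tri w = (x, y, z)"
  defines "A \<equiv> alcove a b w"
  shows "A \<subseteq> {v. 0 \<le> (a + b) \<bullet> v \<and> (a + b) \<bullet> v \<le> 1} \<longleftrightarrow> x = 0"
    and "A \<subseteq> {v. 0 \<le> a \<bullet> v \<and> a \<bullet> v \<le> 1} \<longleftrightarrow> y = 0"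
    and "A \<subseteq> {v. 0 \<le> b \<bullet> v \<and> b \<bullet> v \<le> 1} \<longleftrightarrow> z = 0"
    and "A \<subseteq> {v. (a + b) \<bullet> v > 1} \<longleftrightarrow> x < 0"
    and "A \<subseteq> {v. a \<bullet> v < 0} \<longleftrightarrow> y < 0"
    and "A \<subseteq> {v. b \<bullet> v < 0} \<longleftrightarrow> z < 0"
    and "A \<subseteq> {v. (a + b) \<bullet> v < 0} \<longleftrightarrow> x > 0"
    and "A \<subseteq> {v. a \<bullet> v > 1} \<longleftrightarrow> y > 0"
    and "A \<subseteq> {v. b \<bullet> v > 1} \<longleftrightarrow> z > 0"
proof -
  have A: "A = {v. bary v \<in> open_cell (x, y, z)}"
    unfolding A_def using alcove_eq[OF models_tri[OF assms(1)]] assms(2) by simp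
  obtain c where "bary c \<in> open_cell (x, y, z)"
    using center_in_cell tri_triples[OF assms(1)] assms(2) by metis
  then have c: "c \<in> A" unfolding A by simp
  have b: "of_int x < 1 - (a + b) \<bullet> v \<and> 1 - (a + b) \<bullet> v < of_int x + 1"
      "of_int y < a \<bullet> v \<and> a \<bullet> v < of_int y + 1" "of_int z < b \<bullet> v \<and> b \<bullet> v < of_int z + 1"
    if "v \<in> A" for v
    using that unfolding A by (auto simp: bary_def open_cell_def)
  \<comment> \<open>Passing from \<open>(a + b) \<bullet> v\<close> to \<open>f_0\<close> keeps the
    strip and exchanges its two sides.\<close>
  have "{v. 0 \<le> (a + b) \<bullet> v \<and> (a + b) \<bullet> v \<le> 1} = {v. 0 \<le> 1 - (a + b) \<bullet> v \<and> 1 - (a + b) \<bullet> v \<le> 1}"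
    "{v. (a + b) \<bullet> v > 1} = {v. 1 - (a + b) \<bullet> v < 0}"
    "{v. (a + b) \<bullet> v < 0} = {v. 1 - (a + b) \<bullet> v > 1}"
    by auto
  then show "A \<subseteq> {v. 0 \<le> (a + b) \<bullet> v \<and> (a + b) \<bullet> v \<le> 1} \<longleftrightarrow> x = 0"
    "A \<subseteq> {v. (a + b) \<bullet> v > 1} \<longleftrightarrow> x < 0"
    "A \<subseteq> {v. (a + b) \<bullet> v < 0} \<longleftrightarrow> x > 0"
    using slab_cases[OF c b(1)] by simp_all
  show "A \<subseteq> {v. 0 \<le> a \<bullet> v \<and> a \<bullet> v \<le> 1} \<longleftrightarrow> y = 0"
    "A \<subseteq> {v. a \<bullet> v < 0} \<longleftrightarrow> y < 0"
    "A \<subseteq> {v. a \<bullet> v > 1} \<longleftrightarrow> y > 0"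
    by (rule slab_cases[OF c b(2)]; assumption)+
  show "A \<subseteq> {v. 0 \<le> b \<bullet> v \<and> b \<bullet> v \<le> 1} \<longleftrightarrow> z = 0"
    "A \<subseteq> {v. b \<bullet> v < 0} \<longleftrightarrow> z < 0"
    "A \<subseteq> {v. b \<bullet> v > 1} \<longleftrightarrow> z > 0"
    by (rule slab_cases[OF c b(3)]; assumption)+
qed

fun spiral_triple :: "triple \<Rightarrow> bool" where
  "spiral_triple (x, y, z) \<longleftrightarrow> x = 0 \<or> y = 0 \<or> z = 0"

lemma spiral_iff:
  assumes "w \<in> weyl a b"
  shows "spiral a b w \<longleftrightarrow> spiral_triple (tri w)"
proof -
  obtain x y z where n: "tri w = (x, y, z)" by (cases "tri w")
  show ?thesis
    using assms unfolding spiral_def fund_strips_def image_insert image_empty bex_simps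
      alcove_slabs[OF assms n] n spiral_triple.simps by blast
qed

lemma in_even_chamber_iff:
  assumes "w \<in> weyl a b"
  shows "in_even_chamber a b w \<longleftrightarrow> even_triple (tri w)"
proof -
  obtain x y z where n: "tri w = (x, y, z)" by (cases "tri w")
  show ?thesis
    unfolding in_even_chamber_def even_chambers_def bex_simps Collect_conj_eq le_inf_iff
      alcove_slabs[OF assms n] n even_triple.simps by blast
qed

lemma in_odd_chamber_iff:
  assumes "w \<in> weyl a b"
  shows "in_odd_chamber a b w \<longleftrightarrow> odd_triple (tri w)"
proof -
  obtain x y z where n: "tri w = (x, y, z)" by (cases "tri w")
  show ?thesis
    unfolding in_odd_chamber_def odd_chambers_def bex_simps Collect_conj_eq le_inf_iff
      alcove_slabs[OF assms n] n odd_triple.simps by blast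
qed

end

section \<open>Right multiplication and twisted spirals\<close>

context A2_plane
begin

text \<open>An alcove with coordinate sum 0 is cut out by the lower bounds of the three
  \<open>f_i\<close> alone, so crossing one of its walls decreases exactly one coordinate by
  1.\<close>

fun lower :: "family \<Rightarrow> triple \<Rightarrow> triple" where
  "lower F0 (x, y, z) = (x - 1, y, z)"
| "lower F1 (x, y, z) = (x, y - 1, z)"
| "lower F2 (x, y, z) = (x, y, z - 1)"

text \<open>Right multiplication by a simple reflection crosses the image of one wall of the
  fundamental alcove; the linear part of \<open>act\<close> tells to which family that image
  belongs.\<close>

lemma act_wall:
  assumes "n = (x, y, z)" "x + y + z = 0"
  shows "act n (bary_reflect i 0 P) = act (lower
    (if (y - z) mod 3 = 0 then i
     else if (y - z) mod 3 = 1 then case_family F2 F0 F1 i else case_family F1 F2 F0 i) n) P"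
proof -
  obtain p q r where P: "P = (p, q, r)" by (cases P)
  consider "(y - z) mod 3 = 0" | "(y - z) mod 3 = 1" | "(y - z) mod 3 \<noteq> 0" "(y - z) mod 3 \<noteq> 1"
    by blast
  then show ?thesis
  proof cases
    case 1
    then have "(y - 1 - z) mod 3 = 2" "(y - (z - 1)) mod 3 = 1" by presburger+
    then show ?thesis using 1 assms by (cases i) (simp_all add: P act_def)
  next
    case 2
    then have "(y - 1 - z) mod 3 = 0" "(y - (z - 1)) mod 3 = 2" by presburger+
    then show ?thesis using 2 assms by (cases i) (simp_all add: P act_def)
  next
    case 3
    then have "(y - 1 - z) mod 3 = 1" "(y - (z - 1)) mod 3 = 0" by presburger+
    then show ?thesis using 3 assms by (cases i) (simp_all add: P act_def)
  qed
qed

lemma lower_triples: "n = (x, y, z) \<Longrightarrow> x + y + z = 0 \<Longrightarrow> lower i n \<in> triples"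
  by (cases i) auto

lemma tri_simple_right:
  assumes "w \<in> weyl a b" "tri w = (x, y, z)" "x + y + z = 0"
  shows "\<exists>g. bij g \<and> (\<forall>i. models (w \<circ> wall i 0) (lower (g i) (tri w)))"
proof -
  let ?g = "\<lambda>i. if (y - z) mod 3 = 0 then i
     else if (y - z) mod 3 = 1 then case_family F2 F0 F1 i else case_family F1 F2 F0 i"
  have "bij ?g"
  proof (rule o_bij)
    let ?h = "\<lambda>i. if (y - z) mod 3 = 0 then i
     else if (y - z) mod 3 = 1 then case_family F1 F2 F0 i else case_family F2 F0 F1 i"
    show "?h \<circ> ?g = id" "?g \<circ> ?h = id" by (auto simp: fun_eq_iff split: family.split)
  qed
  moreover have "models (w \<circ> wall i 0) (lower (?g i) (tri w))" for i
    using models_tri[OF assms(1)] act_wall[OF assms(2,3)] lower_triples[OF assms(2,3)]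
    unfolding models_def by (simp only: o_apply bary_wall) blast
  ultimately show ?thesis by blast
qed

lemma even_len: "(x, y, z) \<in> triples \<Longrightarrow> even (len (x, y, z)) \<longleftrightarrow> x + y + z = 0"
  by (simp add: even_nat_iff) presburger

lemma family_of_simple: "(\<exists>i \<in> {0, 1, 2}. P (simple_refl a b i)) \<longleftrightarrow> (\<exists>i. P (wall i 0))"
proof
  assume "\<exists>i. P (wall i 0)"
  then obtain i where "P (wall i 0)" by blast
  moreover have "wall i 0 = simple_refl a b (case_family 0 1 2 i)"
    by (cases i) (simp_all add: simple_refl_eq ix_def)
  moreover have "case_family 0 1 2 i \<in> {0, 1, 2 :: nat}" by (cases i) auto
  ultimately show "\<exists>i \<in> {0, 1, 2}. P (simple_refl a b i)" by metis
qed (auto simp: simple_refl_eq)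

text \<open>An even spiral has coordinate sum 0, hence a zero coordinate and two opposite ones.
  Lowering another coordinate keeps that zero and gives a spiral again; a non-spiral neighbour
  arises only when the zero becomes \<open>- 1\<close>.\<close>

lemma twisted_spiral_iff:
  assumes w: "w \<in> weyl a b"
  shows "twisted_spiral a b w \<longleftrightarrow> twisted_triple (tri w)"
proof -
  have "twisted_spiral a b w \<longleftrightarrow> \<not> spiral_triple (tri w) \<and>
     (\<exists>z i. z \<in> weyl a b \<and> spiral_triple (tri z) \<and> even (len (tri z)) \<and>
        w = z \<circ> wall i 0 \<and> len (tri w) = len (tri z) + 1)"
    using family_of_simple[of "\<lambda>r. spiral a b z \<and> even (weyl_length a b z) \<and>
        w = z \<circ> r \<and> weyl_length a b w = weyl_length a b z + 1" for z]
      spiral_iff weyl_length_eq w spiral_def unfolding twisted_spiral_def by metis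
  also have "\<dots> \<longleftrightarrow> \<not> spiral_triple (tri w) \<and>
     (\<exists>m i. m \<in> triples \<and> spiral_triple m \<and> even (len m) \<and>
        tri w = lower i m \<and> len (tri w) = len m + 1)"
  proof (intro conj_cong refl iffI)
    assume "\<exists>z i. z \<in> weyl a b \<and> spiral_triple (tri z) \<and> even (len (tri z)) \<and>
        w = z \<circ> wall i 0 \<and> len (tri w) = len (tri z) + 1"
    then obtain z i where z: "z \<in> weyl a b" "spiral_triple (tri z)" "even (len (tri z))"
        "w = z \<circ> wall i 0" "len (tri w) = len (tri z) + 1" by blast
    obtain x1 x2 x3 where n: "tri z = (x1, x2, x3)" by (cases "tri z")
    have "x1 + x2 + x3 = 0" using z(3) even_len[of x1 x2 x3] tri_triples[OF z(1)] unfolding n by blast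
    then obtain g where "models (z \<circ> wall i 0) (lower (g i) (tri z))"
      using tri_simple_right[OF z(1) n] by blast
    then have "tri w = lower (g i) (tri z)" unfolding z(4) by (rule tri_eqI)
    then show "\<exists>m i. m \<in> triples \<and> spiral_triple m \<and> even (len m) \<and>
        tri w = lower i m \<and> len (tri w) = len m + 1"
      using z tri_triples by blast
  next
    assume "\<exists>m i. m \<in> triples \<and> spiral_triple m \<and> even (len m) \<and>
        tri w = lower i m \<and> len (tri w) = len m + 1"
    then obtain m i where m: "m \<in> triples" "spiral_triple m" "even (len m)"
        "tri w = lower i m" "len (tri w) = len m + 1" by blast
    obtain z where z: "z \<in> weyl a b" "tri z = m" using tri_surj m(1) by blast
    obtain x1 x2 x3 where n: "tri z = (x1, x2, x3)" by (cases "tri z")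
    have "x1 + x2 + x3 = 0" using m(3) even_len[of x1 x2 x3] tri_triples[OF z(1)] n z(2) by metis
    then obtain g where g: "bij g" "\<And>i. models (z \<circ> wall i 0) (lower (g i) (tri z))"
      using tri_simple_right[OF z(1) n] by blast
    obtain j where "g j = i" using g(1) by (metis bij_pointE)
    then have "w = z \<circ> wall j 0"
      using g(2)[of j] models_tri[OF w] m(4) z(2) models_inject by metis
    then show "\<exists>z i. z \<in> weyl a b \<and> spiral_triple (tri z) \<and> even (len (tri z)) \<and>
        w = z \<circ> wall i 0 \<and> len (tri w) = len (tri z) + 1"
      using m z by blast
  qed
  also have "\<dots> \<longleftrightarrow> twisted_triple (tri w)"
  proof -
    obtain x y z where n: "tri w = (x, y, z)" by (cases "tri w")
    show ?thesis
    proof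
      assume "\<not> spiral_triple (tri w) \<and> (\<exists>m i. m \<in> triples \<and> spiral_triple m \<and> even (len m) \<and>
        tri w = lower i m \<and> len (tri w) = len m + 1)"
      then obtain m i where m: "\<not> spiral_triple (tri w)" "m \<in> triples" "spiral_triple m" "even (len m)"
        "tri w = lower i m" by blast
      obtain x1 x2 x3 where m': "m = (x1, x2, x3)" by (cases m)
      have "x1 + x2 + x3 = 0" using m(2,4) even_len unfolding m' by blast
      then show "twisted_triple (tri w)"
        using m unfolding m' by (cases i) auto
    next
      assume *: "twisted_triple (tri w)"
      then have "\<not> spiral_triple (tri w)" unfolding n by auto
      moreover have "\<exists>m i. m \<in> triples \<and> spiral_triple m \<and> even (len m) \<and>
        tri w = lower i m \<and> len (tri w) = len m + 1"
      proof -
        consider "x = - 1" "z = - y" "y \<noteq> 0" | "y = - 1" "x = - z" "z \<noteq> 0" | "z = - 1" "y = - x" "x \<noteq> 0"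
          using * unfolding n by auto
        then show ?thesis
        proof cases
          case 1
          have "even (len (0, y, - y))" using even_len[of 0 y "- y"] by simp
          then show ?thesis using 1 unfolding n
            by (intro exI[of _ "(0, y, - y)"] exI[of _ F0]) auto
        next
          case 2
          have "even (len (- z, 0, z))" using even_len[of "- z" 0 z] by simp
          then show ?thesis using 2 unfolding n
            by (intro exI[of _ "(- z, 0, z)"] exI[of _ F1]) auto
        next
          case 3
          have "even (len (x, - x, 0))" using even_len[of x "- x" 0] by simp
          then show ?thesis using 3 unfolding n
            by (intro exI[of _ "(x, - x, 0)"] exI[of _ F2]) auto
        qed
      qed
      ultimately show "\<not> spiral_triple (tri w) \<and> (\<exists>m i. m \<in> triples \<and> spiral_triple m \<and>
        even (len m) \<and> tri w = lower i m \<and> len (tri w) = len m + 1)" by blast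
    qed
  qed
  finally show ?thesis .
qed

section \<open>Vertices and edges shared with the strips\<close>

lemma convex_closed_cell: "convex {v. bary v \<in> closed_cell n}"
proof -
  obtain x y z where n: "n = (x, y, z)" by (cases n)
  have "{v. bary v \<in> closed_cell n} =
      {v. (a + b) \<bullet> v \<le> 1 - x} \<inter> {v. (a + b) \<bullet> v \<ge> - x} \<inter> {v. a \<bullet> v \<ge> y} \<inter>
      {v. a \<bullet> v \<le> y + 1} \<inter> {v. b \<bullet> v \<ge> z} \<inter> {v. b \<bullet> v \<le> z + 1}"
    by (auto simp: n bary_def closed_cell_def)
  then show ?thesis
    by (simp only:) (intro convex_Int convex_halfspace_le convex_halfspace_ge)
qed

text \<open>The boundary line of the strip supports the closed alcove, so the intersection is a
  face, and a face with one point is an extreme point.\<close>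

lemma shares_vertexI:
  assumes "w \<in> weyl a b" "S \<in> fund_strips a b"
    and "\<And>v. bary v \<in> closed_cell (tri w) \<Longrightarrow> c \<bullet> v \<le> d \<and> (v \<in> S \<longleftrightarrow> c \<bullet> v = d)"
    and "\<And>v. bary v \<in> closed_cell (tri w) \<and> c \<bullet> v = d \<longleftrightarrow> v = p"
  shows "shares_vertex a b w"
proof -
  let ?C = "closure (alcove a b w)"
  have C: "?C = {v. bary v \<in> closed_cell (tri w)}"
    by (rule closure_alcove[OF models_tri[OF assms(1)]])
  have "?C \<inter> {v. c \<bullet> v = d} face_of ?C"
    by (rule face_of_Int_supporting_hyperplane_le)
      (use assms(3) in \<open>simp_all add: C convex_closed_cell\<close>)
  moreover have "?C \<inter> {v. c \<bullet> v = d} = {p}" "?C \<inter> S = {p}"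
    unfolding C using assms(3,4) by blast+
  ultimately show ?thesis
    using assms(2) unfolding shares_vertex_def by (metis face_of_singleton)
qed

lemma shares_edgeI:
  assumes "w \<in> weyl a b" "S \<in> fund_strips a b" "c \<noteq> 0"
    and "\<And>v. bary v \<in> closed_cell (tri w) \<Longrightarrow> c \<bullet> v \<le> d \<and> (v \<in> S \<longleftrightarrow> c \<bullet> v = d)"
    and "bary p \<in> closed_cell (tri w)" "c \<bullet> p = d" "bary q \<in> closed_cell (tri w)" "c \<bullet> q = d" "p \<noteq> q"
  shows "shares_edge a b w"
proof -
  let ?C = "closure (alcove a b w)"
  have C: "?C = {v. bary v \<in> closed_cell (tri w)}"
    by (rule closure_alcove[OF models_tri[OF assms(1)]])
  have "?C \<inter> {v. c \<bullet> v = d} face_of ?C"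
    by (rule face_of_Int_supporting_hyperplane_le)
      (use assms(4) in \<open>simp_all add: C convex_closed_cell\<close>)
  moreover have S: "?C \<inter> {v. c \<bullet> v = d} = ?C \<inter> S"
    unfolding C using assms(4) by blast
  moreover have "aff_dim (?C \<inter> S) = 1"
  proof (rule antisym)
    have "aff_dim (?C \<inter> S) \<le> aff_dim {v. c \<bullet> v = d}"
      unfolding S[symmetric] by (rule aff_dim_subset) blast
    also have "\<dots> = 1"
      using assms(3) base by (simp add: aff_dim_hyperplane A2_base_def)
    finally show "aff_dim (?C \<inter> S) \<le> 1" .
    have "aff_dim {p, q} \<le> aff_dim (?C \<inter> S)"
      unfolding S[symmetric] C using assms by (intro aff_dim_subset) auto
    then show "1 \<le> aff_dim (?C \<inter> S)" using assms by (simp add: aff_dim_2)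
  qed
  ultimately show ?thesis
    using assms(2) unfolding shares_edge_def edge_of_def by metis
qed

text \<open>The coordinate sum is 0, so the closed alcove is given by \<open>f_i \<ge> n_i\<close>,
  and the line \<open>f_i = n_i + 1\<close> meets it only in the opposite vertex. For
  \<open>n_i = - 1\<close> this line bounds a strip.\<close>

lemma even_shares_vertex:
  assumes "w \<in> weyl a b" "tri w \<in> {(- 1, - 1, 2), (- 1, 2, - 1), (2, - 1, - 1)}"
  shows "shares_vertex a b w"
proof -
  \<comment> \<open>Each of the three triples has \<open>- 1\<close> in one of its first two places,
    so two strips cover all cases.\<close>
  obtain y z where "tri w = (- 1, y, z) \<and> y + z = 1 \<or> tri w = (y, - 1, z) \<and> y + z = 1"
    using assms(2) by fastforce
  then consider "tri w = (- 1, y, z)" "y + z = 1" | "tri w = (y, - 1, z)" "y + z = 1" by blast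
  then show ?thesis
  proof cases
    case 1
    then have r: "real_of_int y + z = 1" by (simp flip: of_int_add)
    then obtain p where p: "bary p = (0, y, z)" using bary_surj[of 0 y z] by auto
    show ?thesis
    proof (rule shares_vertexI[OF assms(1)])
      show "{v. 0 \<le> (a + b) \<bullet> v \<and> (a + b) \<bullet> v \<le> 1} \<in> fund_strips a b"
        by (simp add: fund_strips_def)
      show "- (a + b) \<bullet> v \<le> - 1 \<and>
          (v \<in> {v. 0 \<le> (a + b) \<bullet> v \<and> (a + b) \<bullet> v \<le> 1} \<longleftrightarrow> - (a + b) \<bullet> v = - 1)"
        if "bary v \<in> closed_cell (tri w)" for v
        using that unfolding 1 by (auto simp: bary_def closed_cell_def inner_simps)
      show "bary v \<in> closed_cell (tri w) \<and> - (a + b) \<bullet> v = - 1 \<longleftrightarrow> v = p" for v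
        unfolding bary_inject[symmetric] p 1 using r
        by (auto simp: bary_def closed_cell_def inner_simps)
    qed
  next
    case 2
    then have r: "real_of_int y + z = 1" by (simp flip: of_int_add)
    then obtain p where p: "bary p = (y, 0, z)" using bary_surj[of y 0 z] by auto
    show ?thesis
    proof (rule shares_vertexI[OF assms(1)])
      show "{v. 0 \<le> a \<bullet> v \<and> a \<bullet> v \<le> 1} \<in> fund_strips a b"
        by (simp add: fund_strips_def)
      show "a \<bullet> v \<le> 0 \<and> (v \<in> {v. 0 \<le> a \<bullet> v \<and> a \<bullet> v \<le> 1} \<longleftrightarrow> a \<bullet> v = 0)"
        if "bary v \<in> closed_cell (tri w)" for v
        using that unfolding 2 by (auto simp: bary_def closed_cell_def)
      show "bary v \<in> closed_cell (tri w) \<and> a \<bullet> v = 0 \<longleftrightarrow> v = p" for v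
        unfolding bary_inject[symmetric] p 2 using r
        by (auto simp: bary_def closed_cell_def inner_simps)
    qed
  qed
qed

text \<open>The sum is again 0, but now \<open>n_i = 1\<close>: the boundary \<open>f_i = 1\<close>
  of the strip carries a wall of the alcove, which gives an edge in place of a vertex.\<close>

lemma odd_shares_edge:
  assumes "w \<in> weyl a b" "tri w \<in> {(1, 1, - 2), (1, - 2, 1), (- 2, 1, 1)}"
  shows "shares_edge a b w"
proof -
  obtain y z where "tri w = (1, y, z) \<and> y + z = - 1 \<or> tri w = (y, 1, z) \<and> y + z = - 1"
    using assms(2) by fastforce
  then consider "tri w = (1, y, z)" "y + z = - 1" | "tri w = (y, 1, z)" "y + z = - 1" by blast
  then show ?thesis
  proof cases
    case 1
    then have r: "real_of_int y + z = - 1" by (simp flip: of_int_add)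
    then obtain p q where pq: "bary p = (1, y + 1, z)" "bary q = (1, y, z + 1)"
      using bary_surj[of 1 "y + 1" z] bary_surj[of 1 y "z + 1"] by auto
    show ?thesis
    proof (rule shares_edgeI[OF assms(1)])
      show "{v. 0 \<le> (a + b) \<bullet> v \<and> (a + b) \<bullet> v \<le> 1} \<in> fund_strips a b"
        by (simp add: fund_strips_def)
      have "(a + b) \<bullet> (a + b) \<noteq> 0" by (simp add: inner_simps)
      then show "a + b \<noteq> 0" by auto
      show "(a + b) \<bullet> v \<le> 0 \<and>
          (v \<in> {v. 0 \<le> (a + b) \<bullet> v \<and> (a + b) \<bullet> v \<le> 1} \<longleftrightarrow> (a + b) \<bullet> v = 0)"
        if "bary v \<in> closed_cell (tri w)" for v
        using that unfolding 1 by (auto simp: bary_def closed_cell_def inner_simps)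
      show "bary p \<in> closed_cell (tri w)" "bary q \<in> closed_cell (tri w)"
        unfolding pq 1 by (auto simp: closed_cell_def)
      show "(a + b) \<bullet> p = 0" "(a + b) \<bullet> q = 0" "p \<noteq> q"
        using pq by (auto simp: bary_def)
    qed
  next
    case 2
    then have r: "real_of_int y + z = - 1" by (simp flip: of_int_add)
    then obtain p q where pq: "bary p = (y + 1, 1, z)" "bary q = (y, 1, z + 1)"
      using bary_surj[of "y + 1" 1 z] bary_surj[of y 1 "z + 1"] by auto
    show ?thesis
    proof (rule shares_edgeI[OF assms(1)])
      show "{v. 0 \<le> a \<bullet> v \<and> a \<bullet> v \<le> 1} \<in> fund_strips a b"
        by (simp add: fund_strips_def)
      show "- a \<noteq> 0" using inner_ab(1) by (metis inner_zero_left neg_equal_0_iff_equal zero_neq_numeral)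
      show "- a \<bullet> v \<le> - 1 \<and> (v \<in> {v. 0 \<le> a \<bullet> v \<and> a \<bullet> v \<le> 1} \<longleftrightarrow> - a \<bullet> v = - 1)"
        if "bary v \<in> closed_cell (tri w)" for v
        using that unfolding 2 by (auto simp: bary_def closed_cell_def)
      show "bary p \<in> closed_cell (tri w)" "bary q \<in> closed_cell (tri w)"
        unfolding pq 2 by (auto simp: closed_cell_def)
      show "- a \<bullet> p = - 1" "- a \<bullet> q = - 1" "p \<noteq> q"
        using pq by (auto simp: bary_def)
    qed
  qed
qed

lemma even_len_4:
  assumes "n \<in> triples"
  shows "even_triple n \<and> len n = 4 \<longleftrightarrow> n \<in> {(- 1, - 1, 2), (- 1, 2, - 1), (2, - 1, - 1)}"
proof -
  obtain x y z where n: "n = (x, y, z)" by (cases n)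
  have s: "x + y + z = 0 \<or> x + y + z = - 1" using assms n by simp
  have "even_triple n \<and> \<bar>x\<bar> + \<bar>y\<bar> + \<bar>z\<bar> = 4 \<longleftrightarrow>
      x = - 1 \<and> y = - 1 \<and> z = 2 \<or> x = - 1 \<and> y = 2 \<and> z = - 1 \<or> x = 2 \<and> y = - 1 \<and> z = - 1"
    unfolding n even_triple.simps using s by (smt (verit))
  moreover have "len n = 4 \<longleftrightarrow> \<bar>x\<bar> + \<bar>y\<bar> + \<bar>z\<bar> = 4" by (simp add: n nat_eq_iff)
  ultimately show ?thesis by (simp add: n)
qed

lemma odd_len_4:
  assumes "n \<in> triples"
  shows "odd_triple n \<and> len n = 4 \<longleftrightarrow> n \<in> {(1, 1, - 2), (1, - 2, 1), (- 2, 1, 1)}"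
proof -
  obtain x y z where n: "n = (x, y, z)" by (cases n)
  have s: "x + y + z = 0 \<or> x + y + z = - 1" using assms n by simp
  have "odd_triple n \<and> \<bar>x\<bar> + \<bar>y\<bar> + \<bar>z\<bar> = 4 \<longleftrightarrow>
      x = 1 \<and> y = 1 \<and> z = - 2 \<or> x = 1 \<and> y = - 2 \<and> z = 1 \<or> x = - 2 \<and> y = 1 \<and> z = 1"
    unfolding n odd_triple.simps using s by (smt (verit))
  moreover have "len n = 4 \<longleftrightarrow> \<bar>x\<bar> + \<bar>y\<bar> + \<bar>z\<bar> = 4" by (simp add: n nat_eq_iff)
  ultimately show ?thesis by (simp add: n)
qed

section \<open>The words of length four\<close>

lemma index_permutations:
  "(\<exists>i j k. {i, j, k} = {0, 1, 2 :: nat} \<and> P i j k) \<longleftrightarrow>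
    P 0 1 2 \<or> P 0 2 1 \<or> P 1 0 2 \<or> P 1 2 0 \<or> P 2 0 1 \<or> P 2 1 0"
proof
  assume "\<exists>i j k. {i, j, k} = {0, 1, 2 :: nat} \<and> P i j k"
  then obtain i j k where ijk: "{i, j, k} = {0, 1, 2 :: nat}" "P i j k" by blast
  have "0 \<in> {i, j, k}" "1 \<in> {i, j, k}" "2 \<in> {i, j, k}" unfolding ijk(1) by simp_all
  then show "P 0 1 2 \<or> P 0 2 1 \<or> P 1 0 2 \<or> P 1 2 0 \<or> P 2 0 1 \<or> P 2 1 0"
    using ijk(2) by (elim insertE emptyE; simp)
next
  have "{0, 1, 2} = {0, 1, 2 :: nat}" "{0, 2, 1} = {0, 1, 2 :: nat}" "{1, 0, 2} = {0, 1, 2 :: nat}"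
    "{1, 2, 0} = {0, 1, 2 :: nat}" "{2, 0, 1} = {0, 1, 2 :: nat}" "{2, 1, 0} = {0, 1, 2 :: nat}"
    by (simp_all only: insert_commute)
  moreover assume "P 0 1 2 \<or> P 0 2 1 \<or> P 1 0 2 \<or> P 1 2 0 \<or> P 2 0 1 \<or> P 2 1 0"
  ultimately show "\<exists>i j k. {i, j, k} = {0, 1, 2 :: nat} \<and> P i j k"
    by (elim disjE) (intro exI conjI; assumption)+
qed

lemma word_val_eq_iff:
  assumes "w \<in> weyl a b"
  shows "w = word_val a b is \<longleftrightarrow> tri w = foldr (\<lambda>i. reflect (ix i) 0) is (0, 0, 0)"
  using tri_inject[OF assms word_val_weyl] tri_word_val by metis

text \<open>The braid relation \<open>s_i s_j s_i = s_j s_i s_j\<close> pairs the six permutations,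
  which leaves three elements.\<close>

lemma even_words:
  assumes "w \<in> weyl a b"
  shows "(\<exists>i j k. {i, j, k} = {0, 1, 2} \<and> w = word_val a b [i, j, i, k]) \<longleftrightarrow>
    tri w \<in> {(- 1, - 1, 2), (- 1, 2, - 1), (2, - 1, - 1)}"
  unfolding index_permutations word_val_eq_iff[OF assms] by (simp add: ix_def) blast

lemma odd_words:
  assumes "w \<in> weyl a b"
  shows "(\<exists>i j k. {i, j, k} = {0, 1, 2} \<and> w = word_val a b [k, i, j, i]) \<longleftrightarrow>
    tri w \<in> {(1, 1, - 2), (1, - 2, 1), (- 2, 1, 1)}"
  unfolding index_permutations word_val_eq_iff[OF assms] by (simp add: ix_def) blast

lemma even_case_iff:
  assumes "w \<in> weyl a b"
  shows "in_even_chamber a b w \<and> shares_vertex a b w \<and> weyl_length a b w = 4 \<longleftrightarrow>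
    even_triple (tri w) \<and> len (tri w) = 4"
  using in_even_chamber_iff[OF assms] weyl_length_eq[OF assms] even_shares_vertex[OF assms]
    even_len_4[OF tri_triples[OF assms]] by auto

lemma odd_case_iff:
  assumes "w \<in> weyl a b"
  shows "in_odd_chamber a b w \<and> shares_edge a b w \<and> weyl_length a b w = 4 \<longleftrightarrow>
    odd_triple (tri w) \<and> len (tri w) = 4"
  using in_odd_chamber_iff[OF assms] weyl_length_eq[OF assms] odd_shares_edge[OF assms]
    odd_len_4[OF tri_triples[OF assms]] by auto

lemma cp_condition_classified:
  assumes "w \<in> weyl a b"
  shows "(\<forall>x. bruhat_le a b x w \<longrightarrow> cp_condition a b w x) \<longleftrightarrow>
     weyl_length a b w \<le> 3
            \<or> (in_even_chamber a b w \<and> shares_vertex a b w \<and> weyl_length a b w = 4)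
            \<or> (in_odd_chamber a b w \<and> shares_edge a b w \<and> weyl_length a b w = 4)
            \<or> twisted_spiral a b w"
  unfolding cp_condition_iff[OF assms] smooth_iff_classified[OF tri_triples[OF assms]]
    classified_triple_def even_case_iff[OF assms] odd_case_iff[OF assms]
    twisted_spiral_iff[OF assms]
  unfolding weyl_length_eq[OF assms] ..

lemma even_case_words:
  assumes "w \<in> weyl a b"
  shows "in_even_chamber a b w \<and> shares_vertex a b w \<and> weyl_length a b w = 4 \<longleftrightarrow>
    (\<exists>i j k. {i, j, k} = {0, 1, 2} \<and> w = word_val a b [i, j, i, k])"
  unfolding even_case_iff[OF assms] even_words[OF assms] even_len_4[OF tri_triples[OF assms]] ..

lemma odd_case_words:
  assumes "w \<in> weyl a b"
  shows "in_odd_chamber a b w \<and> shares_edge a b w \<and> weyl_length a b w = 4 \<longleftrightarrow>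
    (\<exists>i j k. {i, j, k} = {0, 1, 2} \<and> w = word_val a b [k, i, j, i])"
  unfolding odd_case_iff[OF assms] odd_words[OF assms] odd_len_4[OF tri_triples[OF assms]] ..

end

section \<open>The loop group\<close>

abbreviation finite_loop :: "loop \<Rightarrow> bool" where
  "finite_loop A \<equiv> finite {k. A k \<noteq> 0}"

lemma matrix_sum_nth: "(\<Sum>k\<in>K. M k) $ i $ j = (\<Sum>k\<in>K. (M k :: complex^3^3) $ i $ j)"
  by (simp add: sum_component)

lemma loop_eval_nth:
  assumes "finite K" "{k. A k \<noteq> 0} \<subseteq> K"
  shows "loop_eval A z $ i $ j = (\<Sum>k\<in>K. A k $ i $ j * z powi k)"
  unfolding loop_eval_def using assms by (auto intro: sum.mono_neutral_left)

lemma finite_loop_mult: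
  assumes "finite_loop A" "finite_loop B"
  shows "finite_loop (loop_mult A B)"
    and "{n. loop_mult A B n \<noteq> 0} \<subseteq> (\<lambda>(k, l). k + l) ` ({k. A k \<noteq> 0} \<times> {k. B k \<noteq> 0})"
proof -
  show *: "{n. loop_mult A B n \<noteq> 0} \<subseteq> (\<lambda>(k, l). k + l) ` ({k. A k \<noteq> 0} \<times> {k. B k \<noteq> 0})"
  proof
    fix n assume "n \<in> {n. loop_mult A B n \<noteq> 0}"
    then obtain k where "k \<in> {k. A k \<noteq> 0}" "A k ** B (n - k) \<noteq> 0"
      unfolding loop_mult_def using sum.not_neutral_contains_not_neutral by force
    then have "A k \<noteq> 0" "B (n - k) \<noteq> 0" by auto
    then show "n \<in> (\<lambda>(k, l). k + l) ` ({k. A k \<noteq> 0} \<times> {k. B k \<noteq> 0})"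
      by (intro image_eqI[of _ _ "(k, n - k)"]) auto
  qed
  show "finite_loop (loop_mult A B)"
    by (rule finite_subset[OF *]) (use assms in simp)
qed

lemma loop_eval_mult:
  assumes "finite_loop A" "finite_loop B" "z \<noteq> 0"
  shows "loop_eval (loop_mult A B) z = loop_eval A z ** loop_eval B z"
proof -
  let ?S = "{k. A k \<noteq> 0}" and ?T = "{k. B k \<noteq> 0}"
  let ?N = "(\<lambda>(k, l). k + l) ` (?S \<times> ?T)"
  have "loop_eval (loop_mult A B) z $ i $ j = (loop_eval A z ** loop_eval B z) $ i $ j" for i j
  proof -
    have inner: "(\<Sum>n\<in>?N. (A k ** B (n - k)) $ i $ j * z powi n) =
        (\<Sum>l\<in>?T. (A k ** B l) $ i $ j * z powi (k + l))" if "k \<in> ?S" for k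
    proof -
      have "(\<Sum>n\<in>?N. (A k ** B (n - k)) $ i $ j * z powi n) =
        (\<Sum>n\<in>(+) k ` ?T. (A k ** B (n - k)) $ i $ j * z powi n)"
      proof (rule sum.mono_neutral_right)
        show "finite ?N" using assms by simp
        show "(+) k ` ?T \<subseteq> ?N" using that by auto
        show "\<forall>n\<in>?N - (+) k ` ?T. (A k ** B (n - k)) $ i $ j * z powi n = 0"
        proof
          fix n assume "n \<in> ?N - (+) k ` ?T"
          then have "B (n - k) = 0" by (metis (mono_tags, lifting) DiffD2 add_diff_cancel_left' diff_add_cancel
            add.commute image_eqI mem_Collect_eq)
          then show "(A k ** B (n - k)) $ i $ j * z powi n = 0" by simp
        qed
      qed
      also have "\<dots> = (\<Sum>l\<in>?T. (A k ** B l) $ i $ j * z powi (k + l))"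
        by (subst sum.reindex) (auto simp: inj_on_def)
      finally show ?thesis .
    qed
    have "loop_eval (loop_mult A B) z $ i $ j = (\<Sum>n\<in>?N. loop_mult A B n $ i $ j * z powi n)"
      by (rule loop_eval_nth) (use assms finite_loop_mult in auto)
    also have "\<dots> = (\<Sum>n\<in>?N. \<Sum>k\<in>?S. (A k ** B (n - k)) $ i $ j * z powi n)"
      unfolding loop_mult_def matrix_sum_nth sum_distrib_right ..
    also have "\<dots> = (\<Sum>k\<in>?S. \<Sum>n\<in>?N. (A k ** B (n - k)) $ i $ j * z powi n)"
      by (rule sum.swap)
    also have "\<dots> = (\<Sum>k\<in>?S. \<Sum>l\<in>?T. (A k ** B l) $ i $ j * z powi (k + l))"
      by (rule sum.cong[OF HOL.refl inner])
    also have "\<dots> = (\<Sum>k\<in>?S. \<Sum>l\<in>?T. \<Sum>m\<in>UNIV. (A k $ i $ m * z powi k) * (B l $ m $ j * z powi l))"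
      using assms(3) by (intro sum.cong HOL.refl)
        (simp add: matrix_matrix_mult_def sum_distrib_right sum_distrib_left power_int_add mult_ac)
    also have "\<dots> = (\<Sum>k\<in>?S. \<Sum>m\<in>UNIV. \<Sum>l\<in>?T. (A k $ i $ m * z powi k) * (B l $ m $ j * z powi l))"
      by (intro sum.cong HOL.refl sum.swap)
    also have "\<dots> = (\<Sum>m\<in>UNIV. \<Sum>k\<in>?S. \<Sum>l\<in>?T. (A k $ i $ m * z powi k) * (B l $ m $ j * z powi l))"
      by (rule sum.swap)
    also have "\<dots> = (loop_eval A z ** loop_eval B z) $ i $ j"
      by (simp add: loop_eval_def matrix_matrix_mult_def sum_product)
    finally show ?thesis .
  qed
  then show ?thesis by (simp add: vec_eq_iff)
qed

text \<open>Multiplication by a power of \<open>z\<close> gives a polynomial with infinitely many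
  roots.\<close>

lemma laurent_zero:
  fixes c :: "int \<Rightarrow> complex"
  assumes "finite K" "\<And>z. z \<noteq> 0 \<Longrightarrow> (\<Sum>k\<in>K. c k * z powi k) = 0" "k \<in> K"
  shows "c k = 0"
proof -
  obtain N where N: "\<And>k. k \<in> K \<Longrightarrow> - int N \<le> k"
  proof
    fix k assume "k \<in> K"
    then have "\<bar>k\<bar> \<le> (\<Sum>k\<in>K. \<bar>k\<bar>)" using assms(1) by (intro member_le_sum) auto
    then show "- int (nat (\<Sum>k\<in>K. \<bar>k\<bar>)) \<le> k" by linarith
  qed
  define p where "p = (\<Sum>k\<in>K. Polynomial.monom (c k) (nat (k + int N)))"
  have "poly p z = 0" if "z \<noteq> 0" for z
  proof -
    have "poly p z = (\<Sum>k\<in>K. c k * z powi k * z ^ N)"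
      unfolding p_def poly_sum
    proof (rule sum.cong[OF HOL.refl])
      fix k assume "k \<in> K"
      then have "z powi k * z ^ N = z ^ nat (k + int N)"
        using N[of k] that by (simp flip: power_int_of_nat power_int_add)
      then show "poly (Polynomial.monom (c k) (nat (k + int N))) z = c k * z powi k * z ^ N"
        by (simp add: poly_monom)
    qed
    then show ?thesis using assms(2)[OF that] by (simp flip: sum_distrib_right)
  qed
  then have "UNIV = insert 0 {z. poly p z = 0}" by auto
  then have "infinite {z. poly p z = 0}"
    using infinite_UNIV_char_0[where ?'a = complex] finite_insert by metis
  then have "p = 0" using poly_roots_finite by blast
  then have "0 = Polynomial.coeff p (nat (k + int N))" by simp
  also have "\<dots> = (\<Sum>l\<in>K. if l = k then c l else 0)"
    unfolding p_def coeff_sum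
  proof (rule sum.cong[OF HOL.refl])
    fix l assume "l \<in> K"
    then show "Polynomial.coeff (Polynomial.monom (c l) (nat (l + int N))) (nat (k + int N)) = (if l = k then c l else 0)"
      using N[of l] N[of k] assms(3) by auto
  qed
  also have "\<dots> = c k" using assms by simp
  finally show ?thesis by simp
qed

text \<open>With \<open>loop_eval_mult\<close> this turns associativity and inverses of loops into
  statements about matrices, in place of convolutions.\<close>

lemma loop_eqI:
  assumes "finite_loop A" "finite_loop B" "\<And>z. z \<noteq> 0 \<Longrightarrow> loop_eval A z = loop_eval B z"
  shows "A = B"
proof
  fix k
  let ?K = "{k. A k \<noteq> 0} \<union> {k. B k \<noteq> 0}"
  show "A k = B k"
  proof (cases "k \<in> ?K")
    case True
    have "A k $ i $ j - B k $ i $ j = 0" for i j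
    proof (rule laurent_zero[of ?K "\<lambda>k. A k $ i $ j - B k $ i $ j"])
      fix z :: complex assume "z \<noteq> 0"
      then have "loop_eval A z $ i $ j - loop_eval B z $ i $ j = 0" using assms(3) by simp
      then show "(\<Sum>k\<in>?K. (A k $ i $ j - B k $ i $ j) * z powi k) = 0"
        using assms(1,2) by (simp add: loop_eval_nth[of ?K] left_diff_distrib sum_subtractf)
    qed (use assms True in auto)
    then show ?thesis by (simp add: vec_eq_iff)
  qed simp
qed

lemma loop_eval_add:
  assumes "finite_loop A" "finite_loop B"
  shows "loop_eval (\<lambda>k. A k + B k) z = loop_eval A z + loop_eval B z"
    "finite_loop (\<lambda>k. A k + B k)"
proof -
  let ?K = "{k. A k \<noteq> 0} \<union> {k. B k \<noteq> 0}"
  have sub: "{k. A k + B k \<noteq> 0} \<subseteq> ?K" by auto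
  then show "finite_loop (\<lambda>k. A k + B k)"
    by (rule finite_subset) (use assms in simp)
  show "loop_eval (\<lambda>k. A k + B k) z = loop_eval A z + loop_eval B z"
    using assms sub by (simp add: vec_eq_iff loop_eval_nth[of ?K] distrib_right sum.distrib)
qed

lemma matrix_scalar_mult: "(mat c :: complex^3^3) ** M = (\<chi> i j. c * M $ i $ j)"
  by (simp add: vec_eq_iff matrix_matrix_mult_def mat_def if_distrib if_distribR sum.delta cong: if_cong)

lemma loop_eval_trace:
  assumes "finite_loop A"
  shows "loop_eval (\<lambda>k. mat (c * trace (A k))) z = mat (c * trace (loop_eval A z))"
    "finite_loop (\<lambda>k. (mat (c * trace (A k)) :: complex^3^3))"
proof -
  have "(mat (c * trace (A k)) :: complex^3^3) = 0" if "A k = 0" for k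
    by (simp add: that trace_def mat_def vec_eq_iff)
  then have sub: "{k. (mat (c * trace (A k)) :: complex^3^3) \<noteq> 0} \<subseteq> {k. A k \<noteq> 0}"
    by blast
  then show "finite_loop (\<lambda>k. (mat (c * trace (A k)) :: complex^3^3))"
    by (rule finite_subset) (use assms in simp)
  show "loop_eval (\<lambda>k. mat (c * trace (A k))) z = mat (c * trace (loop_eval A z))"
    using assms sub
    by (simp add: vec_eq_iff loop_eval_nth[of "{k. A k \<noteq> 0}"] mat_def trace_def sum_3
      sum.distrib sum_distrib_left distrib_left distrib_right mult_ac)
qed

lemma finite_loop_one: "finite_loop loop_one"
  by (rule finite_subset[of _ "{0}"]) (auto simp: loop_one_def)

lemma loop_eval_one: "loop_eval loop_one z = mat 1"
proof -
  have "loop_eval loop_one z $ i $ j = mat 1 $ i $ j" for i j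
    by (subst loop_eval_nth[of "{0}"]) (auto simp: loop_one_def)
  then show ?thesis by (simp add: vec_eq_iff)
qed

text \<open>Built only from products, sums and scalar loops, so polynomial loops with triangular
  constant term are preserved, as \<open>borel_inv\<close> needs. The product of \<open>T\<close>
  and \<open>A\<close> has trace minus the square of the trace of \<open>A\<close>, which supplies
  that square.\<close>

definition loop_inv :: "loop \<Rightarrow> loop" where
  "loop_inv A =
    (let AA = loop_mult A A; T = (\<lambda>k. mat (- 1 * trace (A k))) in
     (\<lambda>k. AA k + (loop_mult T A k + (mat (- 1 / 2 * trace (AA k)) + mat (- 1 / 2 * trace (loop_mult T A k))))))"

text \<open>Cayley--Hamilton for a matrix of determinant \<open>1\<close>; the second elementary symmetric function
  of the eigenvalues is half of \<open>(trace M)\<^sup>2 - trace (M\<^sup>2)\<close>.\<close>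

lemma cayley_hamilton_inverse:
  fixes M :: "complex^3^3"
  assumes "det M = 1"
  shows "M ** (M ** M + (mat (- 1 * trace M) ** M + (mat (- 1 / 2 * trace (M ** M)) +
    mat (- 1 / 2 * trace (mat (- 1 * trace M) ** M))))) = mat 1"
proof -
  have d: "M$1$1 * M$2$2 * M$3$3 + M$1$2 * M$2$3 * M$3$1 + M$1$3 * M$2$1 * M$3$2
      - M$1$1 * M$2$3 * M$3$2 - M$1$2 * M$2$1 * M$3$3 - M$1$3 * M$2$2 * M$3$1 = 1"
    using assms by (simp add: det_3)
  define e where "e = M$1$1 * M$2$2 - M$1$2 * M$2$1 + M$1$1 * M$3$3 - M$1$3 * M$3$1
      + M$2$2 * M$3$3 - M$2$3 * M$3$2"
  have "- 1 / 2 * trace (M ** M) + - 1 / 2 * trace (mat (- 1 * trace M) ** M) = e"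
    unfolding matrix_scalar_mult
    by (simp add: e_def matrix_matrix_mult_def sum_3 trace_def field_simps)
  then have "mat (- 1 / 2 * trace (M ** M)) + mat (- 1 / 2 * trace (mat (- 1 * trace M) ** M)) =
      (mat e :: complex^3^3)"
    by (simp add: vec_eq_iff mat_def)
  moreover have "M ** (M ** M + (mat (- 1 * trace M) ** M + mat e)) = mat 1"
    unfolding matrix_scalar_mult
    using d
    by (simp add: vec_eq_iff forall_3 matrix_matrix_mult_def sum_3 mat_def trace_def e_def algebra_simps)
  ultimately show ?thesis by (simp only:)
qed

lemma loop_inv_eval:
  assumes "finite_loop A"
  shows "finite_loop (loop_inv A)"
    and "z \<noteq> 0 \<Longrightarrow> det (loop_eval A z) = 1 \<Longrightarrow> loop_eval A z ** loop_eval (loop_inv A) z = mat 1"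
proof -
  have fin: "finite_loop (loop_mult A A)"
    "finite_loop (loop_mult (\<lambda>k. mat (- 1 * trace (A k))) A)"
    using assms by (intro finite_loop_mult loop_eval_trace(2); assumption)+
  show "finite_loop (loop_inv A)"
    unfolding loop_inv_def Let_def
    by (intro loop_eval_add(2) loop_eval_trace(2) fin)
  show "loop_eval A z ** loop_eval (loop_inv A) z = mat 1" if "z \<noteq> 0" "det (loop_eval A z) = 1"
    unfolding loop_inv_def Let_def
    using cayley_hamilton_inverse[OF that(2)]
    by (simp only: loop_eval_add loop_eval_trace fin assms
      loop_eval_mult[OF assms assms that(1)] loop_eval_mult[OF loop_eval_trace(2)[OF assms] assms that(1)])
qed

lemma SL3_finite: "A \<in> SL3_loops \<Longrightarrow> finite_loop A"
  by (simp add: SL3_loops_def)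

lemma SL3_det: "A \<in> SL3_loops \<Longrightarrow> z \<noteq> 0 \<Longrightarrow> det (loop_eval A z) = 1"
  by (simp add: SL3_loops_def)

lemma SL3_mult: "A \<in> SL3_loops \<Longrightarrow> B \<in> SL3_loops \<Longrightarrow> loop_mult A B \<in> SL3_loops"
  by (simp add: SL3_loops_def finite_loop_mult loop_eval_mult det_mul)

lemma SL3_one: "loop_one \<in> SL3_loops"
  by (simp add: SL3_loops_def finite_loop_one loop_eval_one)

lemma SL3_inv: "A \<in> SL3_loops \<Longrightarrow> loop_inv A \<in> SL3_loops"
  unfolding SL3_loops_def
proof clarify
  assume A: "finite_loop A" "\<forall>z. z \<noteq> 0 \<longrightarrow> det (loop_eval A z) = 1"
  have "det (loop_eval (loop_inv A) z) = 1" if "z \<noteq> 0" for z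
  proof -
    have "det (loop_eval A z ** loop_eval (loop_inv A) z) = 1"
      using loop_inv_eval(2)[OF A(1) that] A(2) that by simp
    then show ?thesis using A(2) that by (simp add: det_mul)
  qed
  then show "finite_loop (loop_inv A) \<and> (\<forall>z. z \<noteq> 0 \<longrightarrow> det (loop_eval (loop_inv A) z) = 1)"
    using loop_inv_eval(1)[OF A(1)] by blast
qed

lemma loop_mult_assoc:
  assumes "A \<in> SL3_loops" "B \<in> SL3_loops" "C \<in> SL3_loops"
  shows "loop_mult (loop_mult A B) C = loop_mult A (loop_mult B C)"
  by (rule loop_eqI)
    (use assms in \<open>simp_all add: SL3_finite finite_loop_mult loop_eval_mult matrix_mul_assoc\<close>)

lemma loop_mult_one:
  assumes "A \<in> SL3_loops"
  shows "loop_mult loop_one A = A" "loop_mult A loop_one = A"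
  by (rule loop_eqI;
    use assms in \<open>simp add: SL3_finite finite_loop_mult finite_loop_one loop_eval_mult loop_eval_one\<close>)+

lemma loop_mult_inv:
  assumes "A \<in> SL3_loops"
  shows "loop_mult A (loop_inv A) = loop_one" "loop_mult (loop_inv A) A = loop_one"
proof -
  note fin = SL3_finite[OF assms] SL3_finite[OF SL3_inv[OF assms]]
  have "loop_eval A z ** loop_eval (loop_inv A) z = mat 1" if "z \<noteq> 0" for z
    using loop_inv_eval(2)[OF fin(1) that SL3_det[OF assms that]] .
  then show "loop_mult A (loop_inv A) = loop_one" "loop_mult (loop_inv A) A = loop_one"
    using matrix_left_right_inverse
    by (intro loop_eqI;
      simp add: fin finite_loop_mult finite_loop_one loop_eval_mult loop_eval_one; blast)+
qed

section \<open>The Borel subgroup\<close>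

lemma borel_SL3: "A \<in> std_borel \<Longrightarrow> A \<in> SL3_loops"
  by (simp add: std_borel_def)

definition polynomial_loop :: "loop \<Rightarrow> bool" where
  "polynomial_loop A \<longleftrightarrow> (\<forall>k < 0. A k = 0)"

definition upper :: "complex^3^3 \<Rightarrow> bool" where
  "upper M \<longleftrightarrow> M $ 2 $ 1 = 0 \<and> M $ 3 $ 1 = 0 \<and> M $ 3 $ 2 = 0"

lemma upper_mult: "upper M \<Longrightarrow> upper N \<Longrightarrow> upper (M ** N)"
  by (simp add: upper_def matrix_matrix_mult_def sum_3)

lemma upper_add: "upper M \<Longrightarrow> upper N \<Longrightarrow> upper (M + N)"
  by (simp add: upper_def)

lemma upper_mat: "upper (mat c)"
  by (simp add: upper_def mat_def)

lemma mem_borel: "A \<in> std_borel \<longleftrightarrow> A \<in> SL3_loops \<and> polynomial_loop A \<and> upper (A 0)"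
  by (auto simp: std_borel_def polynomial_loop_def upper_def)

lemma polynomial_loop_mult:
  assumes "finite_loop A" "polynomial_loop A" "polynomial_loop B"
  shows "polynomial_loop (loop_mult A B)" "loop_mult A B 0 = A 0 ** B 0"
proof -
  have "A k ** B (n - k) = 0" if "n < 0 \<or> n = 0 \<and> k \<noteq> 0" for n k
  proof (cases "k < 0")
    case True
    then show ?thesis using assms(2) by (simp add: polynomial_loop_def)
  next
    case False
    then have "n - k < 0" using that by linarith
    then show ?thesis using assms(3) by (simp add: polynomial_loop_def)
  qed
  note z = this
  show "polynomial_loop (loop_mult A B)"
    unfolding polynomial_loop_def loop_mult_def using z by (auto intro: sum.neutral)
  have "(\<Sum>k | A k \<noteq> 0. A k ** B (0 - k)) = (\<Sum>k \<in> insert 0 {k. A k \<noteq> 0}. A k ** B (0 - k))"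
    using assms(1) by (intro sum.mono_neutral_left) auto
  also have "\<dots> = (\<Sum>k \<in> {0}. A k ** B (0 - k))"
  proof (rule sum.mono_neutral_right)
    show "\<forall>k \<in> insert 0 {k. A k \<noteq> 0} - {0}. A k ** B (0 - k) = 0"
      using z[of 0] by blast
  qed (use assms(1) in simp_all)
  finally show "loop_mult A B 0 = A 0 ** B 0" by (simp add: loop_mult_def)
qed

lemma borel_mult:
  assumes "A \<in> std_borel" "B \<in> std_borel"
  shows "loop_mult A B \<in> std_borel"
  using assms unfolding mem_borel
  by (simp add: SL3_mult SL3_finite polynomial_loop_mult upper_mult)

lemma borel_one: "loop_one \<in> std_borel"
  unfolding mem_borel using SL3_one by (simp add: polynomial_loop_def loop_one_def upper_mat)

lemma borel_inv:
  assumes "A \<in> std_borel"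
  shows "loop_inv A \<in> std_borel"
proof -
  let ?T = "\<lambda>k. mat (- 1 * trace (A k)) :: complex^3^3"
  have A: "A \<in> SL3_loops" "finite_loop A" "polynomial_loop A" "upper (A 0)"
    using assms SL3_finite unfolding mem_borel by blast+
  have tr: "(mat (c * trace (0 :: complex^3^3)) :: complex^3^3) = 0" for c
    by (simp add: trace_def mat_def vec_eq_iff)
  have T: "finite_loop ?T" "polynomial_loop ?T"
    using loop_eval_trace(2)[OF A(2), of "- 1"] A(3) tr[of "- 1"]
    unfolding polynomial_loop_def by simp_all
  note p = polynomial_loop_mult(1)[OF A(2,3,3), unfolded polynomial_loop_def, rule_format]
    polynomial_loop_mult(1)[OF T A(3), unfolded polynomial_loop_def, rule_format]
  have "loop_inv A k = 0" if "k < 0" for k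
    unfolding loop_inv_def Let_def p(1)[OF that] p(2)[OF that] tr by simp
  then have "polynomial_loop (loop_inv A)" unfolding polynomial_loop_def by blast
  moreover have "upper (loop_inv A 0)"
    unfolding loop_inv_def Let_def polynomial_loop_mult(2)[OF A(2,3,3)]
      polynomial_loop_mult(2)[OF T A(3)]
    by (intro upper_add upper_mult upper_mat A(4))
  ultimately show ?thesis using SL3_inv[OF A(1)] unfolding mem_borel by blast
qed

section \<open>Continuity of left translations\<close>

lemma SL3_bounded_subset: "SL3_bounded N \<subseteq> SL3_loops"
  by (auto simp: SL3_bounded_def)

lemma SL3_bounded_ex:
  assumes "A \<in> SL3_loops" shows "\<exists>N. A \<in> SL3_bounded N"
proof (intro exI)
  let ?K = "{k. A k \<noteq> 0}"
  have fin: "finite ?K" by (rule SL3_finite[OF assms])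
  have "A k = 0" if "\<bar>k\<bar> > int (nat (\<Sum>k\<in>?K. \<bar>k\<bar>))" for k
  proof (rule ccontr)
    assume "A k \<noteq> 0"
    then have "\<bar>k\<bar> \<le> (\<Sum>k\<in>?K. \<bar>k\<bar>)" using fin by (intro member_le_sum) auto
    then show False using that by linarith
  qed
  then show "A \<in> SL3_bounded (nat (\<Sum>k\<in>?K. \<bar>k\<bar>))"
    unfolding SL3_bounded_def using assms by blast
qed

lemma SL3_bounded_mult:
  assumes "A \<in> SL3_bounded M" "B \<in> SL3_bounded N"
  shows "loop_mult A B \<in> SL3_bounded (M + N)"
proof -
  have AB: "A \<in> SL3_loops" "B \<in> SL3_loops" using assms SL3_bounded_subset by blast+
  have "loop_mult A B n = 0" if "\<bar>n\<bar> > int (M + N)" for n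
    unfolding loop_mult_def
  proof (rule sum.neutral, rule ballI)
    fix k
    have "\<bar>k\<bar> > int M \<or> \<bar>n - k\<bar> > int N" using that by linarith
    then show "A k ** B (n - k) = 0"
      using assms by (auto simp: SL3_bounded_def)
  qed
  then show ?thesis using SL3_mult[OF AB] by (simp add: SL3_bounded_def)
qed

lemma continuous_on_loop_mult: "continuous_on S (loop_mult g)"
proof (rule continuous_on_coordinatewise_then_product)
  fix n
  have coord: "continuous_on S (\<lambda>A :: loop. A m)" for m
    by (rule continuous_on_product_coordinates[THEN continuous_on_subset]) simp
  show "continuous_on S (\<lambda>A. loop_mult g A n)"
    unfolding loop_mult_def matrix_matrix_mult_def
    by (intro continuous_intros coord)
qed

text \<open>A translation need not preserve the stages of the direct limit, but it maps stage
  \<open>N\<close> into stage \<open>M + N\<close>, where \<open>M\<close> bounds the exponents of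
  \<open>g\<close>.\<close>

lemma openin_loop_mult:
  assumes "g \<in> SL3_loops" "openin loop_topology U"
  shows "openin loop_topology {A \<in> SL3_loops. loop_mult g A \<in> U}"
  unfolding openin_loop_topology
proof (intro conjI allI)
  fix N
  obtain M where M: "g \<in> SL3_bounded M" using SL3_bounded_ex[OF assms(1)] by blast
  have "openin (top_of_set (SL3_bounded N)) (SL3_bounded N \<inter> loop_mult g -` (U \<inter> SL3_bounded (M + N)))"
  proof (rule continuous_openin_preimage[OF continuous_on_loop_mult])
    show "loop_mult g \<in> SL3_bounded N \<rightarrow> SL3_bounded (M + N)"
      using SL3_bounded_mult[OF M] by blast
    show "openin (top_of_set (SL3_bounded (M + N))) (U \<inter> SL3_bounded (M + N))"
      using assms(2) openin_loop_topology by blast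
  qed
  also have "SL3_bounded N \<inter> loop_mult g -` (U \<inter> SL3_bounded (M + N)) =
      {A \<in> SL3_loops. loop_mult g A \<in> U} \<inter> SL3_bounded N"
    using SL3_bounded_mult[OF M] SL3_bounded_subset by blast
  finally show "openin (top_of_set (SL3_bounded N)) ({A \<in> SL3_loops. loop_mult g A \<in> U} \<inter> SL3_bounded N)" .
qed blast

lemma topspace_flag_topology: "topspace flag_topology = flag ` SL3_loops"
proof -
  have "openin loop_topology SL3_loops"
    unfolding openin_loop_topology
  proof (intro conjI allI)
    fix N
    have "SL3_loops \<inter> SL3_bounded N = SL3_bounded N" using SL3_bounded_subset by blast
    then show "openin (top_of_set (SL3_bounded N)) (SL3_loops \<inter> SL3_bounded N)" by simp
  qed simp
  moreover have "{A \<in> SL3_loops. flag A \<in> flag ` SL3_loops} = SL3_loops" by blast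
  ultimately have "openin flag_topology (flag ` SL3_loops)"
    unfolding openin_flag_topology by simp
  moreover have "U \<subseteq> flag ` SL3_loops" if "openin flag_topology U" for U
    using that unfolding openin_flag_topology by blast
  ultimately show ?thesis
    by (metis openin_subset openin_topspace subset_antisym)
qed

lemma mult_flag:
  assumes "g \<in> SL3_loops" "A \<in> SL3_loops"
  shows "loop_mult g ` flag A = flag (loop_mult g A)"
  unfolding flag_def image_image
  by (rule image_cong) (use assms loop_mult_assoc borel_SL3 in auto)

lemma continuous_map_mult_flag:
  assumes "g \<in> SL3_loops"
  shows "continuous_map flag_topology flag_topology ((`) (loop_mult g))"
  unfolding continuous_map topspace_flag_topology
proof (intro conjI allI impI)
  show "(`) (loop_mult g) ` (flag ` SL3_loops) \<subseteq> flag ` SL3_loops"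
    using assms mult_flag SL3_mult by auto
  fix U assume U: "openin flag_topology U"
  have "{A \<in> SL3_loops. flag A \<in> {x \<in> flag ` SL3_loops. loop_mult g ` x \<in> U}} =
      {A \<in> SL3_loops. loop_mult g A \<in> {A \<in> SL3_loops. flag A \<in> U}}"
    using mult_flag[OF assms] SL3_mult[OF assms] by auto
  moreover have "openin loop_topology {A \<in> SL3_loops. flag A \<in> U}"
    using U unfolding openin_flag_topology by blast
  ultimately have "openin loop_topology
      {A \<in> SL3_loops. flag A \<in> {x \<in> flag ` SL3_loops. loop_mult g ` x \<in> U}}"
    using openin_loop_mult[OF assms] by (simp only:)
  then show "openin flag_topology {x \<in> flag ` SL3_loops. loop_mult g ` x \<in> U}"
    unfolding openin_flag_topology by blast
qed

section \<open>The Borel action on a Schubert variety\<close>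

lemma simple_lift_SL3: "simple_lift i \<in> SL3_loops"
proof -
  have sub: "{k. simple_lift i k \<noteq> 0} \<subseteq> {- 1, 0, 1}"
    by (auto simp: simple_lift_def split: if_splits)
  have fin: "finite_loop (simple_lift i)"
    by (rule finite_subset[OF sub]) simp
  have "det (loop_eval (simple_lift i) z) = 1" if "z \<noteq> 0" for z
    unfolding det_3 loop_eval_nth[OF _ sub, simplified]
    using that by (simp add: simple_lift_def power_int_minus)
  then show ?thesis using fin by (simp add: SL3_loops_def)
qed

lemma word_lift_SL3: "word_lift is \<in> SL3_loops"
  by (induction "is") (simp_all add: word_lift_def SL3_one SL3_mult simple_lift_SL3)

lemma schubert_points_SL3: "schubert_points a b w \<subseteq> flag ` SL3_loops"
  unfolding schubert_points_def using SL3_mult borel_SL3 word_lift_SL3 by blast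

lemma mult_schubert_points:
  assumes "g \<in> std_borel" "F \<in> schubert_points a b w"
  shows "loop_mult g ` F \<in> schubert_points a b w"
proof -
  obtain h "is" where F: "F = flag (loop_mult h (word_lift is))" "h \<in> std_borel" "is \<in> words"
      "bruhat_le a b (word_val a b is) w"
    using assms(2) unfolding schubert_points_def by blast
  have "loop_mult g ` F = flag (loop_mult (loop_mult g h) (word_lift is))"
    unfolding F(1) using assms(1) F(2) word_lift_SL3 borel_SL3
    by (simp add: mult_flag SL3_mult loop_mult_assoc)
  then show ?thesis
    unfolding schubert_points_def using borel_mult[OF assms(1) F(2)] F(3,4) by blast
qed

lemma mult_inv_flag:
  assumes "g \<in> SL3_loops" "F \<in> flag ` SL3_loops"
  shows "loop_mult g ` (loop_mult (loop_inv g) ` F) = F" "loop_mult (loop_inv g) ` (loop_mult g ` F) = F"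
proof -
  obtain A where "A \<in> SL3_loops" "F = flag A" using assms(2) by blast
  then show "loop_mult g ` (loop_mult (loop_inv g) ` F) = F" "loop_mult (loop_inv g) ` (loop_mult g ` F) = F"
    using assms(1) SL3_inv[OF assms(1)] loop_mult_inv[OF assms(1)]
    by (simp_all add: mult_flag SL3_mult loop_mult_one flip: loop_mult_assoc)
qed

lemma topspace_schubert: "topspace (schubert_variety a b w) = schubert_points a b w"
  using schubert_points_SL3[of a b w] by (auto simp: schubert_variety_def topspace_flag_topology)

lemma continuous_map_mult_schubert:
  assumes "g \<in> std_borel"
  shows "continuous_map (schubert_variety a b w) (schubert_variety a b w) ((`) (loop_mult g))"
  unfolding schubert_variety_def
proof (rule continuous_map_into_subtopology)
  show "continuous_map (subtopology flag_topology (schubert_points a b w)) flag_topology ((`) (loop_mult g))"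
    by (rule continuous_map_from_subtopology[OF continuous_map_mult_flag[OF borel_SL3[OF assms]]])
  show "(`) (loop_mult g) \<in> topspace (subtopology flag_topology (schubert_points a b w)) \<rightarrow> schubert_points a b w"
    using mult_schubert_points[OF assms] by auto
qed

lemma homeomorphic_maps_mult_schubert:
  assumes "g \<in> std_borel"
  shows "homeomorphic_maps (schubert_variety a b w) (schubert_variety a b w)
    ((`) (loop_mult g)) ((`) (loop_mult (loop_inv g)))"
  unfolding homeomorphic_maps_def topspace_schubert
proof (intro conjI ballI)
  show "continuous_map (schubert_variety a b w) (schubert_variety a b w) ((`) (loop_mult g))"
    by (rule continuous_map_mult_schubert[OF assms])
  show "continuous_map (schubert_variety a b w) (schubert_variety a b w) ((`) (loop_mult (loop_inv g)))"
    by (rule continuous_map_mult_schubert[OF borel_inv[OF assms]])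
next
  fix F assume "F \<in> schubert_points a b w"
  then have F: "F \<in> flag ` SL3_loops" using schubert_points_SL3[of a b w] by blast
  show "loop_mult (loop_inv g) ` (loop_mult g ` F) = F" "loop_mult g ` (loop_mult (loop_inv g) ` F) = F"
    by (rule mult_inv_flag[OF borel_SL3[OF assms] F])+
qed

section \<open>Homeomorphism invariance of rational smoothness\<close>

lemma continuous_map_restrict:
  assumes "continuous_map Y X k" "k ` T \<subseteq> S"
  shows "continuous_map (subtopology Y T) (subtopology X S) k"
  using assms by (intro continuous_map_into_subtopology continuous_map_from_subtopology) auto

lemma rel_cochain_pullback:
  assumes "rel_cochain n X S \<phi>" "continuous_map Y X k" "k ` T \<subseteq> S"
  shows "rel_cochain n Y T (\<lambda>c. \<phi> (chain_map n k c))"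
  using assms(1) singular_chain_chain_map[OF _ assms(2)]
    singular_chain_chain_map[OF _ continuous_map_restrict[OF assms(2,3)]]
  unfolding rel_cochain_def by (simp add: chain_map_add)

lemma rel_cocycle_pullback:
  assumes "rel_cocycle n X S \<phi>" "continuous_map Y X k" "k ` T \<subseteq> S"
  shows "rel_cocycle n Y T (\<lambda>c. \<phi> (chain_map n k c))"
  unfolding rel_cocycle_def
proof (intro conjI allI impI)
  show "rel_cochain n Y T (\<lambda>c. \<phi> (chain_map n k c))"
    using assms rel_cochain_pullback unfolding rel_cocycle_def by blast
  fix c assume c: "singular_chain (Suc n) Y c"
  have "chain_map n k (chain_boundary (Suc n) c) = chain_boundary (Suc n) (chain_map (Suc n) k c)"
    using chain_boundary_chain_map[OF c, of k] by simp
  then show "\<phi> (chain_map n k (chain_boundary (Suc n) c)) = 0"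
    using assms(1) singular_chain_chain_map[OF c assms(2)] unfolding rel_cocycle_def by simp
qed

lemma rel_coboundary_pullback:
  assumes "rel_coboundary n X S \<phi>" "continuous_map Y X k" "k ` T \<subseteq> S"
  shows "rel_coboundary n Y T (\<lambda>c. \<phi> (chain_map n k c))"
proof -
  obtain \<psi> where \<psi>: "rel_cochain (n - 1) X S \<psi>"
      "\<And>c. singular_chain n X c \<Longrightarrow> \<phi> c = \<psi> (chain_boundary n c)"
    using assms(1) unfolding rel_coboundary_def by blast
  have "\<phi> (chain_map n k c) = \<psi> (chain_map (n - 1) k (chain_boundary n c))"
    if "singular_chain n Y c" for c
    using \<psi>(2)[OF singular_chain_chain_map[OF that assms(2)]] chain_boundary_chain_map[OF that, of k]
    by simp
  then show ?thesis
    unfolding rel_coboundary_def using rel_cochain_pullback[OF \<psi>(1) assms(2,3)] by blast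
qed

text \<open>A cochain is a function on all chains, but only its values on singular chains of
  \<open>X\<close> matter. Pulling back along a homeomorphism and its inverse restores it only
  there.\<close>

lemma rel_coboundary_cong:
  assumes "rel_coboundary n X S \<phi>" "\<And>c. singular_chain n X c \<Longrightarrow> \<phi> c = \<psi> c"
  shows "rel_coboundary n X S \<psi>"
  using assms unfolding rel_coboundary_def by metis

text \<open>The composite of \<open>h\<close> and \<open>k\<close> is the identity only on the
  underlying space, which is where singular chains live.\<close>

lemma chain_map_inverse:
  assumes "homeomorphic_maps X Y h k" "singular_chain n X c"
  shows "chain_map n k (chain_map n h c) = c"
proof -
  have "chain_map n (k \<circ> h) c = c"
    using assms by (intro chain_map_id_gen) (auto simp: homeomorphic_maps_def)
  then show ?thesis by (simp add: chain_map_compose)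
qed

lemma cohomology_homeomorphic:
  assumes "homeomorphic_maps X Y h k" "h ` S \<subseteq> T" "k ` T \<subseteq> S"
  shows "cohomology_zero n X S \<Longrightarrow> cohomology_zero n Y T"
    and "cohomology_rat n X S \<Longrightarrow> cohomology_rat n Y T"
proof -
  have h: "continuous_map X Y h" and k: "continuous_map Y X k"
    using assms(1) unfolding homeomorphic_maps_def by blast+
  have hk: "chain_map n h (chain_map n k c) = c" if "singular_chain n Y c" for c
    using chain_map_inverse[OF _ that] assms(1) homeomorphic_maps_sym by blast
  have kh: "chain_map n k (chain_map n h c) = c" if "singular_chain n X c" for c
    by (rule chain_map_inverse[OF assms(1) that])
  \<comment> \<open>Being a coboundary on \<open>Y\<close> may be tested after pullback to
    \<open>X\<close>, since pullback along \<open>k\<close> leads back.\<close>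
  have transfer: "rel_coboundary n Y T \<psi>" if "rel_coboundary n X S (\<lambda>c. \<psi> (chain_map n h c))" for \<psi>
    by (rule rel_coboundary_cong[OF rel_coboundary_pullback[OF that k assms(3)]]) (simp add: hk)
  show "cohomology_zero n Y T" if "cohomology_zero n X S"
    using that transfer rel_cocycle_pullback[OF _ h assms(2)] unfolding cohomology_zero_def by blast
  assume "cohomology_rat n X S"
  then obtain \<phi> where \<phi>: "rel_cocycle n X S \<phi>" "\<not> rel_coboundary n X S \<phi>"
      "\<And>\<psi>. rel_cocycle n X S \<psi> \<Longrightarrow> \<exists>q. rel_coboundary n X S (\<lambda>c. \<psi> c - q * \<phi> c)"
    unfolding cohomology_rat_def by blast
  show "cohomology_rat n Y T"
    unfolding cohomology_rat_def
  proof (intro exI[of _ "\<lambda>c. \<phi> (chain_map n k c)"] conjI allI impI)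
    show "rel_cocycle n Y T (\<lambda>c. \<phi> (chain_map n k c))"
      by (rule rel_cocycle_pullback[OF \<phi>(1) k assms(3)])
    show "\<not> rel_coboundary n Y T (\<lambda>c. \<phi> (chain_map n k c))"
    proof
      assume "rel_coboundary n Y T (\<lambda>c. \<phi> (chain_map n k c))"
      then have "rel_coboundary n X S (\<lambda>c. \<phi> (chain_map n k (chain_map n h c)))"
        by (rule rel_coboundary_pullback[OF _ h assms(2)])
      then have "rel_coboundary n X S \<phi>"
        by (rule rel_coboundary_cong) (simp add: kh)
      then show False using \<phi>(2) by blast
    qed
    fix \<psi> assume "rel_cocycle n Y T \<psi>"
    then have "rel_cocycle n X S (\<lambda>c. \<psi> (chain_map n h c))"
      by (rule rel_cocycle_pullback[OF _ h assms(2)])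
    then obtain q where q: "rel_coboundary n X S (\<lambda>c. \<psi> (chain_map n h c) - q * \<phi> c)"
      using \<phi>(3) by blast
    have "rel_coboundary n Y T (\<lambda>c. \<psi> c - q * \<phi> (chain_map n k c))"
      by (rule transfer, rule rel_coboundary_cong[OF q]) (simp add: kh)
    then show "\<exists>q. rel_coboundary n Y T (\<lambda>c. \<psi> c - q * \<phi> (chain_map n k c))" by blast
  qed
qed

lemma rationally_smooth_at_homeomorphic:
  assumes "homeomorphic_maps X Y h k" "rationally_smooth_at d X p"
  shows "rationally_smooth_at d Y (h p)"
proof -
  obtain U where U: "openin X U" "p \<in> U"
    and sm: "\<And>x i. x \<in> U \<Longrightarrow> if i = 2 * d then cohomology_rat i X (topspace X - {x})
        else cohomology_zero i X (topspace X - {x})"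
    using assms(2) unfolding rationally_smooth_at_def by blast
  have hom: "homeomorphic_map X Y h" using assms(1) homeomorphic_maps_map by blast
  have inv: "k (h x) = x" "h x \<in> topspace Y" if "x \<in> topspace X" for x
    using assms(1) that unfolding homeomorphic_maps_def continuous_map by auto
  have inv': "h (k y) = y" "k y \<in> topspace X" if "y \<in> topspace Y" for y
    using assms(1) that unfolding homeomorphic_maps_def continuous_map by auto
  have "openin Y (h ` U)" using hom U(1) homeomorphic_map_openness_eq by blast
  moreover have "if i = 2 * d then cohomology_rat i Y (topspace Y - {h x})
        else cohomology_zero i Y (topspace Y - {h x})" if "x \<in> U" for x i
  proof -
    have x: "x \<in> topspace X" using that U(1) openin_subset by blast
    have "h ` (topspace X - {x}) \<subseteq> topspace Y - {h x}"
    proof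
      fix y assume "y \<in> h ` (topspace X - {x})"
      then obtain u where "u \<in> topspace X" "u \<noteq> x" "y = h u" by blast
      then show "y \<in> topspace Y - {h x}" using inv x by (metis DiffI singletonD)
    qed
    moreover have "k ` (topspace Y - {h x}) \<subseteq> topspace X - {x}"
    proof
      fix u assume "u \<in> k ` (topspace Y - {h x})"
      then obtain y where "y \<in> topspace Y" "y \<noteq> h x" "u = k y" by blast
      then show "u \<in> topspace X - {x}" using inv' by (metis DiffI singletonD)
    qed
    ultimately show ?thesis
      using sm[OF that, of i] cohomology_homeomorphic[OF assms(1)] by (metis (full_types))
  qed
  ultimately show ?thesis
    unfolding rationally_smooth_at_def using U(2) by (intro exI[of _ "h ` U"]) auto
qed

lemma flag_word_lift_schubert:
  assumes "is \<in> words" "bruhat_le a b (word_val a b is) w"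
  shows "flag (word_lift is) \<in> schubert_points a b w"
  unfolding schubert_points_def
  using borel_one assms loop_mult_one(1)[OF word_lift_SL3]
  by (intro CollectI exI[of _ loop_one] exI[of _ "is"]) simp

text \<open>The Borel subgroup acts on the Schubert variety by homeomorphisms, and every orbit contains
  a torus fixed point.\<close>

lemma rationally_smooth_iff_fixed_points:
  "(\<forall>p \<in> schubert_points a b w. rationally_smooth_at d (schubert_variety a b w) p) \<longleftrightarrow>
   (\<forall>is \<in> words. bruhat_le a b (word_val a b is) w \<longrightarrow>
     rationally_smooth_at d (schubert_variety a b w) (flag (word_lift is)))"
proof
  assume *: "\<forall>is \<in> words. bruhat_le a b (word_val a b is) w \<longrightarrow>
     rationally_smooth_at d (schubert_variety a b w) (flag (word_lift is))"
  show "\<forall>p \<in> schubert_points a b w. rationally_smooth_at d (schubert_variety a b w) p"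
  proof
    fix p assume "p \<in> schubert_points a b w"
    then obtain g "is" where p: "p = flag (loop_mult g (word_lift is))" "g \<in> std_borel" "is \<in> words"
        "bruhat_le a b (word_val a b is) w"
      unfolding schubert_points_def by blast
    then have "p = loop_mult g ` flag (word_lift is)"
      by (simp add: mult_flag borel_SL3 word_lift_SL3)
    then show "rationally_smooth_at d (schubert_variety a b w) p"
      using * p rationally_smooth_at_homeomorphic[OF homeomorphic_maps_mult_schubert[OF p(2)]]
      by blast
  qed
qed (use flag_word_lift_schubert in blast)

text \<open>The Carrell-Peterson equivalence enters as the premise of the first conjunct, stated at
  the torus fixed points; \<open>rationally_smooth_iff_fixed_points\<close> links these to all
  points of the variety. The other conjuncts are combinatorial.\<close>

theorem corollary7p1:
  fixes a b :: "'v::euclidean_space" and w :: "'v \<Rightarrow> 'v"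
  assumes "A2_base a b" and "w \<in> weyl a b"
  shows
    "let classified =
           (weyl_length a b w \<le> 3
            \<or> (in_even_chamber a b w \<and> shares_vertex a b w \<and> weyl_length a b w = 4)
            \<or> (in_odd_chamber a b w \<and> shares_edge a b w \<and> weyl_length a b w = 4)
            \<or> twisted_spiral a b w)
     in
       ((\<forall>is \<in> words. bruhat_le a b (word_val a b is) w \<longrightarrow>
            (rationally_smooth_at (weyl_length a b w) (schubert_variety a b w) (flag (word_lift is))
             \<longleftrightarrow> cp_condition a b w (word_val a b is)))
        \<longrightarrow> ((\<forall>p \<in> schubert_points a b w.
                rationally_smooth_at (weyl_length a b w) (schubert_variety a b w) p)
             \<longleftrightarrow> classified))
       \<and> ((\<forall>x. bruhat_le a b x w \<longrightarrow> cp_condition a b w x) \<longleftrightarrow> classified)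
       \<and> ((in_even_chamber a b w \<and> shares_vertex a b w \<and> weyl_length a b w = 4)
          \<longleftrightarrow> (\<exists>i j k. {i, j, k} = {0, 1, 2} \<and> w = word_val a b [i, j, i, k]))
       \<and> ((in_odd_chamber a b w \<and> shares_edge a b w \<and> weyl_length a b w = 4)
          \<longleftrightarrow> (\<exists>i j k. {i, j, k} = {0, 1, 2} \<and> w = word_val a b [k, i, j, i]))"
proof -
  interpret A2_plane a b by (rule A2_plane.intro[OF assms(1)])
  \<comment> \<open>Every group element is spelled by a word, so quantifying over words reaches all
    elements below \<open>w\<close>.\<close>
  have fixed_points: "(\<forall>is \<in> words. bruhat_le a b (word_val a b is) w \<longrightarrow>
        cp_condition a b w (word_val a b is)) \<longleftrightarrow>
      (\<forall>x. bruhat_le a b x w \<longrightarrow> cp_condition a b w x)"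
    using weyl_word bruhat_le_iff by metis
  show ?thesis
    unfolding Let_def
  proof (intro conjI impI)
    assume "\<forall>is \<in> words. bruhat_le a b (word_val a b is) w \<longrightarrow>
      (rationally_smooth_at (weyl_length a b w) (schubert_variety a b w) (flag (word_lift is))
       \<longleftrightarrow> cp_condition a b w (word_val a b is))"
    then show "(\<forall>p \<in> schubert_points a b w.
        rationally_smooth_at (weyl_length a b w) (schubert_variety a b w) p) \<longleftrightarrow>
      weyl_length a b w \<le> 3
      \<or> (in_even_chamber a b w \<and> shares_vertex a b w \<and> weyl_length a b w = 4)
      \<or> (in_odd_chamber a b w \<and> shares_edge a b w \<and> weyl_length a b w = 4)
      \<or> twisted_spiral a b w"
      unfolding rationally_smooth_iff_fixed_points cp_condition_classified[OF assms(2), symmetric]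
        fixed_points[symmetric] by blast
  qed (rule cp_condition_classified[OF assms(2)] even_case_words[OF assms(2)]
    odd_case_words[OF assms(2)])+
qed

end
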